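(* The reactive integer min-cost flow problem with uncertain arc demands associated with the distance in values $d_{val}$, denoted $MCF^{r}_{d_{val}}$, is solvable in polynomial time.
   Context: **Integer flows.** Let $G=(V,A)$ be a digraph with arc capacities $u_a\in\mathbb N$, arc demands (lower bounds) $\ell_a\in\mathbb N$, unitary costs $c_a\in\mathbb R^+$ for $a\in A$, and node demands $b_v\in\mathbb Z$ for $v\in V$. A feasible integer flow for $(G,\ell,u,b)$ is a vector $x\in\mathbb Z^A$ with $\ell_a\le x_a\le u_a$ for all $a\in A$ and (flow on arcs leaving $v$) $-$ (flow on arcs entering $v$) $=b_v$ for all $v\in V$. The nominal (min-cost flow) problem asks for a feasible integer flow for $(G,\ell,u,b)$ minimizing $\sum_{a\in A}c_ax_a$. **Uncertainty.** Uncertainty is on the arc demands: a scenario $\xi$ is given by arc demands $\ell^\xi\in\mathbb N^A$, all other data being unchanged. $X_\xi$ denotes the set of feasible integer flows for $(G,\ell^\xi,u,b)$. **Distance in values.** $d_{val}(x,y)=\sum_{a\in A}|x_a-y_a|$. **Reactive problem $MCF^r_{d_{val}}$.** Input: the data above, a scenario $\xi$, and a given solution $x^{nom}$ of the nominal problem (a feasible integer flow for $(G,\ell,u,b)$). Task: minimize $d_{val}(x^r,x^{nom})$ subject to $x^r\in X_\xi$. **Convention.** Input integers are encoded in binary and costs are rational; solvable in polynomial time means that there is an algorithm which, in time polynomial in the size of the input, returns an optimal solution or reports that $X_\xi=\emptyset$. *)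

theory Defs
  imports
    "Graph_Theory.Digraph"
    "HOL-Library.Log_Nat"
    "HOL-Library.FuncSet"
    "HOL-Computational_Algebra.Polynomial"
begin

section \<open>Model of computation\<close>

text \<open>
  Algorithms are while programs over integer variables and integer arrays: a structured
  random access machine with the instructions of Aho, Hopcroft and Ullman, under the
  \<^emph>\<open>logarithmic\<close> cost criterion. Every integer that is read, computed or used as an address is
  charged its binary length, so that polynomial time here is polynomial time on Turing machines.
\<close>

type_synonym vname = string

datatype aexp =
    N int
  | V vname
  | Idx vname aexp
  | Add aexp aexp
  | Sub aexp aexp
  | Mul aexp aexp
  | Div aexp aexp

datatype bexp = Less aexp aexp | Neg bexp | Conj bexp bexp

datatype com =
    SKIP
  | Assign vname aexp
  | Store vname aexp aexp   \<comment> \<open>\<open>Store a i e\<close> is \<open>a[i] := e\<close>\<close>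
  | Write aexp              \<comment> \<open>append to the write-only output tape\<close>
  | Seq com com
  | Cond bexp com com
  | While bexp com

record state =
  var :: "vname \<Rightarrow> int"
  arr :: "vname \<Rightarrow> int \<Rightarrow> int"
  out_tape :: "int list"

fun aval :: "aexp \<Rightarrow> state \<Rightarrow> int" where
  "aval (N k) s = k"
| "aval (V x) s = var s x"
| "aval (Idx a e) s = arr s a (aval e s)"
| "aval (Add e f) s = aval e s + aval f s"
| "aval (Sub e f) s = aval e s - aval f s"
| "aval (Mul e f) s = aval e s * aval f s"
| "aval (Div e f) s = aval e s div aval f s"

fun bval :: "bexp \<Rightarrow> state \<Rightarrow> bool" where
  "bval (Less e f) s \<longleftrightarrow> aval e s < aval f s"
| "bval (Neg b) s \<longleftrightarrow> \<not> bval b s"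
| "bval (Conj b c) s \<longleftrightarrow> bval b s \<and> bval c s"

text \<open>Length of a signed integer in binary; the additional bit is the sign.\<close>

definition int_size :: "int \<Rightarrow> nat" where
  "int_size z = 1 + floorlog 2 (nat \<bar>z\<bar>)"

fun acost :: "aexp \<Rightarrow> state \<Rightarrow> nat" where
  "acost (N k) s = int_size k"
| "acost (V x) s = int_size (var s x)"
| "acost (Idx a e) s = acost e s + int_size (aval (Idx a e) s)"
| "acost (Add e f) s = acost e s + acost f s + int_size (aval (Add e f) s)"
| "acost (Sub e f) s = acost e s + acost f s + int_size (aval (Sub e f) s)"
| "acost (Mul e f) s = acost e s + acost f s + int_size (aval (Mul e f) s)"
| "acost (Div e f) s = acost e s + acost f s + int_size (aval (Div e f) s)"

fun bcost :: "bexp \<Rightarrow> state \<Rightarrow> nat" where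
  "bcost (Less e f) s = 1 + acost e s + acost f s"
| "bcost (Neg b) s = 1 + bcost b s"
| "bcost (Conj b c) s = 1 + bcost b s + bcost c s"

text \<open>\<open>exec c s t s'\<close>: started in \<open>s\<close>, the program \<open>c\<close> terminates in \<open>s'\<close> at total cost \<open>t\<close>.\<close>

inductive exec :: "com \<Rightarrow> state \<Rightarrow> nat \<Rightarrow> state \<Rightarrow> bool" where
  Skip: "exec SKIP s 1 s"
| Assign: "exec (Assign x e) s (1 + acost e s) (s\<lparr>var := (var s)(x := aval e s)\<rparr>)"
| Store: "exec (Store a i e) s (1 + acost i s + acost e s)
    (s\<lparr>arr := (arr s)(a := (arr s a)(aval i s := aval e s))\<rparr>)"
| Write: "exec (Write e) s (1 + acost e s) (s\<lparr>out_tape := out_tape s @ [aval e s]\<rparr>)"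
| Seq: "exec c s t s' \<Longrightarrow> exec d s' t' s'' \<Longrightarrow> exec (Seq c d) s (1 + t + t') s''"
| CondTrue: "bval b s \<Longrightarrow> exec c s t s' \<Longrightarrow> exec (Cond b c d) s (1 + bcost b s + t) s'"
| CondFalse: "\<not> bval b s \<Longrightarrow> exec d s t s' \<Longrightarrow> exec (Cond b c d) s (1 + bcost b s + t) s'"
| WhileFalse: "\<not> bval b s \<Longrightarrow> exec (While b c) s (1 + bcost b s) s"
| WhileTrue: "bval b s \<Longrightarrow> exec c s t s' \<Longrightarrow> exec (While b c) s' t' s'' \<Longrightarrow>
    exec (While b c) s (1 + bcost b s + t + t') s''"

lemma exec_deterministic: "exec c s t s' \<Longrightarrow> exec c s u s'' \<Longrightarrow> t = u \<and> s' = s''"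
proof (induction arbitrary: u s'' rule: exec.induct)
  case (Skip s)
  from Skip.prems show ?case by cases simp
next
  case (Assign x e s)
  from Assign.prems show ?case by cases simp
next
  case (Store a i e s)
  from Store.prems show ?case by cases simp
next
  case (Write e s)
  from Write.prems show ?case by cases simp
next
  case (Seq c s t s1 d t' s2)
  from Seq.prems show ?case by cases (metis Seq.IH)
next
  case (CondTrue b s c t s1 d)
  from CondTrue.prems show ?case by cases (use CondTrue.hyps CondTrue.IH in \<open>metis\<close>)+
next
  case (CondFalse b s d t s1 c)
  from CondFalse.prems show ?case by cases (use CondFalse.hyps CondFalse.IH in \<open>metis\<close>)+
next
  case (WhileFalse b s c)
  from WhileFalse.prems show ?case by cases (use WhileFalse.hyps in simp_all)
next
  case (WhileTrue b s c t s1 t' s2)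
  from WhileTrue.prems show ?case by cases (use WhileTrue.hyps WhileTrue.IH in \<open>metis\<close>)+
qed

text \<open>The input is preloaded into the array \<open>in\<close>, its number of entries into the variable \<open>len\<close>.\<close>

definition init_state :: "int list \<Rightarrow> state" where
  "init_state xs =
    \<lparr>var = (\<lambda>_. 0)(''len'' := int (length xs)),
     arr = (\<lambda>_ _. 0)(''in'' := (\<lambda>i. if 0 \<le> i \<and> i < int (length xs) then xs ! nat i else 0)),
     out_tape = []\<rparr>"

definition input_size :: "int list \<Rightarrow> nat" where
  "input_size xs = (\<Sum>x\<leftarrow>xs. int_size x)"

definition poly_time_computable ::
  "'i set \<Rightarrow> ('i \<Rightarrow> int list) \<Rightarrow> ('i \<Rightarrow> int list \<Rightarrow> bool) \<Rightarrow> bool" where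
  "poly_time_computable Inst enc ans \<longleftrightarrow>
    (\<exists>(c :: com) (p :: nat poly). \<forall>I\<in>Inst. \<exists>t s.
       exec c (init_state (enc I)) t s \<and> t \<le> poly p (input_size (enc I)) \<and> ans I (out_tape s))"

text \<open>
  A minimization problem has instances \<open>Inst\<close>, the feasible solutions \<open>X I\<close> and the objective
  \<open>f I\<close>. The answer \<open>0\<close> reports infeasibility; the answer \<open>1\<close> is followed by an optimal solution.
\<close>

definition minimization_answer ::
  "('i \<Rightarrow> 's set) \<Rightarrow> ('i \<Rightarrow> 's \<Rightarrow> 'o::order) \<Rightarrow> ('i \<Rightarrow> 's \<Rightarrow> int list) \<Rightarrow> 'i \<Rightarrow> int list \<Rightarrow> bool" where
  "minimization_answer X f enc_sol I ys \<longleftrightarrow>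
    (if X I = {} then ys = [0]
     else \<exists>x. is_arg_min (f I) (\<lambda>x. x \<in> X I) x \<and> ys = 1 # enc_sol I x)"

definition poly_time_minimization ::
  "'i set \<Rightarrow> ('i \<Rightarrow> int list) \<Rightarrow> ('i \<Rightarrow> 's set) \<Rightarrow> ('i \<Rightarrow> 's \<Rightarrow> 'o::order) \<Rightarrow>
    ('i \<Rightarrow> 's \<Rightarrow> int list) \<Rightarrow> bool" where
  "poly_time_minimization Inst enc X f enc_sol \<longleftrightarrow>
    poly_time_computable Inst enc (minimization_answer X f enc_sol)"


section \<open>Integer flows\<close>

text \<open>A vector indexed by the arcs is an extensional function: it is \<open>undefined\<close> off the arcs.\<close>

definition feasible_flows ::
  "('v, 'a) pre_digraph \<Rightarrow> ('a \<Rightarrow> nat) \<Rightarrow> ('a \<Rightarrow> nat) \<Rightarrow> ('v \<Rightarrow> int) \<Rightarrow> ('a \<Rightarrow> int) set" where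
  "feasible_flows G l u b =
    {x \<in> extensional (arcs G).
      (\<forall>a\<in>arcs G. int (l a) \<le> x a \<and> x a \<le> int (u a)) \<and>
      (\<forall>v\<in>verts G. (\<Sum>a\<in>out_arcs G v. x a) - (\<Sum>a\<in>in_arcs G v. x a) = b v)}"

definition d_val :: "('v, 'a) pre_digraph \<Rightarrow> ('a \<Rightarrow> int) \<Rightarrow> ('a \<Rightarrow> int) \<Rightarrow> int" where
  "d_val G x y = (\<Sum>a\<in>arcs G. \<bar>x a - y a\<bar>)"


section \<open>The reactive problem\<close>

record mcf_reactive =
  net :: "(nat, nat) pre_digraph"
  capacity :: "nat \<Rightarrow> nat"
  arc_demand :: "nat \<Rightarrow> nat"
  unit_cost :: "nat \<Rightarrow> rat"
  node_demand :: "nat \<Rightarrow> int"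
  scenario :: "nat \<Rightarrow> nat"      \<comment> \<open>the arc demands of the scenario\<close>
  x_nom :: "nat \<Rightarrow> int"

text \<open>
  In an input, nodes and arcs are numbered consecutively from \<open>0\<close>. Parallel arcs and loops are
  allowed.
\<close>

definition MCF_reactive_instances :: "mcf_reactive set" where
  "MCF_reactive_instances = {I.
    fin_digraph (net I) \<and>
    verts (net I) = {..<card (verts (net I))} \<and>
    arcs (net I) = {..<card (arcs (net I))} \<and>
    (\<forall>a\<in>arcs (net I). 0 \<le> unit_cost I a) \<and>
    x_nom I \<in> feasible_flows (net I) (arc_demand I) (capacity I) (node_demand I)}"

definition encode_instance :: "mcf_reactive \<Rightarrow> int list" where
  "encode_instance I =
    (let n = card (verts (net I)); m = card (arcs (net I)) in
      [int n, int m]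
      @ map (\<lambda>a. int (tail (net I) a)) [0..<m]
      @ map (\<lambda>a. int (head (net I) a)) [0..<m]
      @ map (\<lambda>a. int (capacity I a)) [0..<m]
      @ map (\<lambda>a. int (arc_demand I a)) [0..<m]
      @ map (\<lambda>a. fst (quotient_of (unit_cost I a))) [0..<m]
      @ map (\<lambda>a. snd (quotient_of (unit_cost I a))) [0..<m]
      @ map (node_demand I) [0..<n]
      @ map (\<lambda>a. int (scenario I a)) [0..<m]
      @ map (x_nom I) [0..<m])"

definition encode_flow :: "mcf_reactive \<Rightarrow> (nat \<Rightarrow> int) \<Rightarrow> int list" where
  "encode_flow I x = map x [0..<card (arcs (net I))]"

definition scenario_flows :: "mcf_reactive \<Rightarrow> (nat \<Rightarrow> int) set" where
  "scenario_flows I = feasible_flows (net I) (scenario I) (capacity I) (node_demand I)"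

end

theory Submission
  imports Defs
begin

text \<open>
  The difference to the nominal flow is a circulation. Each arc contributes an optional increase
  and a decrease of cost \<open>1\<close> per unit and an enforced increase of very negative cost; a
  minimum-cost circulation then saturates all enforced increases iff the scenario is feasible. It
  is computed by bit scaling of the capacities. Doubling flow and capacities preserves the kilter
  conditions for integral node potentials, and afterwards each capacity grows by at most one; such
  an increment is repaired by growing a tree of tight residual arcs from the head of the arc,
  raising the potentials outside the tree by the minimal slack, until the tail is reached and one
  unit of flow can be augmented, or the reduced cost of the arc is no longer negative.

  The program contains no multiplication, so each elementary step increases the bit length of the
  stored integers by a constant. Polynomially many iterations of every loop are therefore enough
  for polynomial logarithmic cost, and no bound on the potentials is needed.
\<close>

section \<open>Addition-only programs\<close>

text \<open>The enforced increases are rewarded by a negative cost instead of being demanded by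
  lower bounds. Hence the zero flow is an optimal circulation for zero capacities, scaling can start
  without a first feasible solution, and infeasibility only shows at the end, when some arc still
  violates its bounds. Their cost is \<open>-1 - S\<close>, with \<open>S\<close> the sum of all
  capacities of the constructed network: one missing enforced unit outweighs everything that the
  optional arcs can cost together.

  Capacities are binary numbers, so pushing flow unit by unit would be exponential. With scaling,
  each of linearly many levels causes at most one unit push per arc, and each push takes at most
  \<open>n\<close> rounds of search and a tree path of at most \<open>n\<close> nodes.

  The obstacle is the logarithmic cost, which iteration counts alone do not control: repeated
  squaring makes bit lengths explode. Without products, one number bounds the growth in bits and,
  together with the current bit length, the time. Such budgets add up under sequencing, so the
  program proofs only have to count iterations.\<close>

fun mul_free_exp :: "aexp \<Rightarrow> bool" where
  "mul_free_exp (Idx a e) = mul_free_exp e"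
| "mul_free_exp (Add e f) = (mul_free_exp e \<and> mul_free_exp f)"
| "mul_free_exp (Sub e f) = (mul_free_exp e \<and> mul_free_exp f)"
| "mul_free_exp (Mul e f) = False"
| "mul_free_exp (Div e f) = (mul_free_exp e \<and> mul_free_exp f)"
| "mul_free_exp _ = True"

fun mul_free_bexp :: "bexp \<Rightarrow> bool" where
  "mul_free_bexp (Less e f) = (mul_free_exp e \<and> mul_free_exp f)"
| "mul_free_bexp (Neg b) = mul_free_bexp b"
| "mul_free_bexp (Conj b c) = (mul_free_bexp b \<and> mul_free_bexp c)"

fun mul_free :: "com \<Rightarrow> bool" where
  "mul_free SKIP = True"
| "mul_free (Assign x e) = mul_free_exp e"
| "mul_free (Store a i e) = (mul_free_exp i \<and> mul_free_exp e)"
| "mul_free (Write e) = mul_free_exp e"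
| "mul_free (Seq c d) = (mul_free c \<and> mul_free d)"
| "mul_free (Cond b c d) = (mul_free_bexp b \<and> mul_free c \<and> mul_free d)"
| "mul_free (While b c) = (mul_free_bexp b \<and> mul_free c)"

text \<open>The weight serves twice: it bounds by how many bits a value can exceed the stored
  numbers (\<open>abs_aval_less\<close>), and it occurs in both factors of the cost bound
  (\<open>acost_le\<close>). The additive constants pay for the size charged at each node.\<close>

fun exp_weight :: "aexp \<Rightarrow> nat" where
  "exp_weight (N k) = int_size k + 1"
| "exp_weight (V x) = 2"
| "exp_weight (Idx a e) = exp_weight e + 2"
| "exp_weight (Add e f) = exp_weight e + exp_weight f + 2"
| "exp_weight (Sub e f) = exp_weight e + exp_weight f + 2"
| "exp_weight (Mul e f) = exp_weight e + exp_weight f + 2"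
| "exp_weight (Div e f) = exp_weight e + exp_weight f + 2"

fun bexp_weight :: "bexp \<Rightarrow> nat" where
  "bexp_weight (Less e f) = 1 + exp_weight e + exp_weight f"
| "bexp_weight (Neg b) = 1 + bexp_weight b"
| "bexp_weight (Conj b c) = 1 + bexp_weight b + bexp_weight c"

section \<open>Bit lengths and logarithmic cost of expressions\<close>

definition bits_bound :: "nat \<Rightarrow> state \<Rightarrow> bool" where
  "bits_bound W s \<longleftrightarrow> (\<forall>x. \<bar>var s x\<bar> < 2 ^ W) \<and> (\<forall>a i. \<bar>arr s a i\<bar> < 2 ^ W)"

lemma bits_bound_mono: "bits_bound W s \<Longrightarrow> W \<le> W' \<Longrightarrow> bits_bound W' s"
  unfolding bits_bound_def
  by (meson less_le_trans one_le_numeral power_increasing)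

lemma int_size_le: "\<bar>z\<bar> < 2 ^ W \<Longrightarrow> int_size z \<le> W + 1"
proof -
  assume "\<bar>z\<bar> < 2 ^ W"
  then have "nat \<bar>z\<bar> < 2 ^ W"
    by (metis abs_ge_zero nat_less_iff of_nat_numeral of_nat_power)
  then show ?thesis
    by (simp add: int_size_def floorlog_leI)
qed

lemma abs_less_int_size: "\<bar>z\<bar> < 2 ^ (int_size z - 1)"
proof -
  have "nat \<bar>z\<bar> < 2 ^ floorlog 2 (nat \<bar>z\<bar>)"
  proof (cases "z = 0")
    case False
    then have "0 < nat \<bar>z\<bar>" by simp
    then show ?thesis using floorlog_bounds[of "nat \<bar>z\<bar>" 2] by linarith
  qed simp
  then have "int (nat \<bar>z\<bar>) < int (2 ^ floorlog 2 (nat \<bar>z\<bar>))"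
    by (simp only: of_nat_less_iff)
  then show ?thesis
    by (simp add: int_size_def)
qed

lemma abs_add_less_power:
  fixes a b :: int
  assumes "\<bar>a\<bar> < 2 ^ (W + x)" "\<bar>b\<bar> < 2 ^ (W + y)"
  shows "\<bar>a\<bar> + \<bar>b\<bar> < 2 ^ (W + x + y + 1)"
proof -
  have "(2::int) ^ (W + x) \<le> 2 ^ (W + x + y)" "(2::int) ^ (W + y) \<le> 2 ^ (W + x + y)"
    by (rule power_increasing; simp)+
  moreover have "(2::int) ^ (W + x + y + 1) = 2 ^ (W + x + y) + 2 ^ (W + x + y)" by simp
  ultimately show ?thesis using assms by linarith
qed

lemma abs_div_le: "\<bar>a div b\<bar> \<le> \<bar>a\<bar>" for a b :: int
proof -
  have *: "\<bar>x div y\<bar> \<le> \<bar>x\<bar>" if "y > 0" for x y :: int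
  proof (cases "x \<ge> 0")
    case True
    then have "x div y \<le> x div 1" using that by (intro zdiv_mono2) auto
    moreover have "0 \<le> x div y" using True that by (simp add: pos_imp_zdiv_nonneg_iff)
    ultimately show ?thesis using True by simp
  next
    case False
    have "x * y \<le> x * 1" using False that by (intro mult_left_mono_neg) auto
    then have "(x * y) div y \<le> x div y" using that by (intro zdiv_mono1) auto
    moreover have "x div y < 0" using False that by (simp add: div_neg_pos_less0)
    ultimately show ?thesis using that by simp
  qed
  consider "b = 0" | "b > 0" | "- b > 0" by linarith
  then show ?thesis
  proof cases
    case 3
    then have "\<bar>(- a) div (- b)\<bar> \<le> \<bar>- a\<bar>" by (rule *)
    then show ?thesis by simp
  qed (auto simp: *)
qed

lemma abs_aval_less:
  "mul_free_exp e \<Longrightarrow> bits_bound W s \<Longrightarrow> \<bar>aval e s\<bar> < 2 ^ (W + exp_weight e)"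
proof (induction e)
  case (N k)
  have "\<bar>k\<bar> < 2 ^ (int_size k - 1)" by (rule abs_less_int_size)
  also have "\<dots> \<le> 2 ^ (W + exp_weight (N k))" by (rule power_increasing) auto
  finally show ?case by simp
next
  case (V x)
  then have "\<bar>var s x\<bar> < 2 ^ W" by (simp add: bits_bound_def)
  also have "\<dots> \<le> 2 ^ (W + exp_weight (V x))" by (rule power_increasing) auto
  finally show ?case by simp
next
  case (Idx a e)
  then have "\<bar>arr s a (aval e s)\<bar> < 2 ^ W" by (simp add: bits_bound_def)
  also have "\<dots> \<le> 2 ^ (W + exp_weight (Idx a e))" by (rule power_increasing) auto
  finally show ?case by simp
next
  case (Add e f)
  then have "\<bar>aval e s\<bar> < 2 ^ (W + exp_weight e)" "\<bar>aval f s\<bar> < 2 ^ (W + exp_weight f)"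
    by simp_all
  then have "\<bar>aval (Add e f) s\<bar> < 2 ^ (W + exp_weight e + exp_weight f + 1)"
    using abs_add_less_power[of "aval e s" W "exp_weight e" "aval f s" "exp_weight f"]
    unfolding aval.simps by linarith
  also have "\<dots> \<le> 2 ^ (W + exp_weight (Add e f))" by (rule power_increasing) auto
  finally show ?case .
next
  case (Sub e f)
  then have "\<bar>aval e s\<bar> < 2 ^ (W + exp_weight e)" "\<bar>aval f s\<bar> < 2 ^ (W + exp_weight f)"
    by simp_all
  then have "\<bar>aval (Sub e f) s\<bar> < 2 ^ (W + exp_weight e + exp_weight f + 1)"
    using abs_add_less_power[of "aval e s" W "exp_weight e" "aval f s" "exp_weight f"]
    unfolding aval.simps by linarith
  also have "\<dots> \<le> 2 ^ (W + exp_weight (Sub e f))" by (rule power_increasing) auto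
  finally show ?case .
next
  case (Div e f)
  have "\<bar>aval (Div e f) s\<bar> \<le> \<bar>aval e s\<bar>" by (simp add: abs_div_le)
  also have "\<dots> < 2 ^ (W + exp_weight e)" using Div by simp
  also have "\<dots> \<le> 2 ^ (W + exp_weight (Div e f))" by (rule power_increasing) auto
  finally show ?case .
qed auto

lemma int_size_aval_le:
  "mul_free_exp e \<Longrightarrow> bits_bound W s \<Longrightarrow> int_size (aval e s) \<le> W + exp_weight e + 1"
  using int_size_le[OF abs_aval_less] by simp

lemma exp_weight_pos: "2 \<le> exp_weight e"
  by (cases e) (auto simp: int_size_def)

text \<open>Induction step for the binary operators. The two extra units in \<open>z\<close>
  contribute \<open>2 * (W + z)\<close>, which covers the size \<open>k\<close> of the
  result.\<close>

lemma weighted_cost_add: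
  fixes x y :: nat
  assumes "t \<le> x * (W + x)" "t' \<le> y * (W + y)" "2 \<le> x" "2 \<le> y" "z = x + y + 2"
    "k \<le> W + z + 1"
  shows "t + t' + k \<le> z * (W + z)"
proof -
  have "x * (W + x) + x \<le> x * (W + z)" "y * (W + y) \<le> y * (W + z)"
    using assms by (auto simp: algebra_simps)
  then show ?thesis using assms by (auto simp: algebra_simps)
qed

lemma acost_le:
  "mul_free_exp e \<Longrightarrow> bits_bound W s \<Longrightarrow> acost e s \<le> exp_weight e * (W + exp_weight e)"
proof (induction e)
  case (N k)
  show ?case by (simp add: algebra_simps)
next
  case (V x)
  then show ?case using int_size_aval_le[of "V x" W s] by simp
next
  case (Idx a e)
  then have "acost e s \<le> exp_weight e * (W + exp_weight e)" by simp
  moreover have "int_size (aval (Idx a e) s) \<le> W + 1"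
    by (rule int_size_le) (use Idx.prems in \<open>simp add: bits_bound_def\<close>)
  ultimately show ?case by (auto simp: algebra_simps)
next
  case (Add e f)
  then show ?case using int_size_aval_le[OF Add.prems]
    unfolding acost.simps by (intro weighted_cost_add[OF _ _ exp_weight_pos exp_weight_pos]) auto
next
  case (Sub e f)
  then show ?case using int_size_aval_le[OF Sub.prems]
    unfolding acost.simps by (intro weighted_cost_add[OF _ _ exp_weight_pos exp_weight_pos]) auto
next
  case (Div e f)
  then show ?case using int_size_aval_le[OF Div.prems]
    unfolding acost.simps by (intro weighted_cost_add[OF _ _ exp_weight_pos exp_weight_pos]) auto
qed auto

text \<open>The second command starts from numbers that the first has lengthened by up to
  \<open>x\<close> bits. Both bit factors are at most \<open>W + (1 + x + y)\<close>, so the budgets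
  of consecutive commands simply add.\<close>

lemma budget_seq:
  fixes x y :: nat
  assumes "t \<le> x * (W + x)" "t' \<le> y * (W + x + y)"
  shows "1 + t + t' \<le> (1 + x + y) * (W + (1 + x + y))"
  using assms by (simp add: algebra_simps)

lemma bcost_le:
  "mul_free_bexp b \<Longrightarrow> bits_bound W s \<Longrightarrow> bcost b s \<le> bexp_weight b * (W + bexp_weight b)"
proof (induction b)
  case (Less e f)
  then show ?case using acost_le[of e W s] acost_le[of f W s]
    by (simp add: algebra_simps)
next
  case (Neg b)
  then show ?case by (simp add: algebra_simps)
next
  case (Conj b c)
  then show ?case by (simp add: algebra_simps)
qed

text \<open>One number \<open>n\<close> limits the growth in bits and, through
  \<open>n * (W + n)\<close>, the cost. Quantifying over \<open>W\<close> after the run is fixed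
  makes the bound usable in the middle of a longer run, when the numbers have already grown. With
  \<open>mul_free\<close> as a premise inside, the proof rules carry no syntactic side
  condition.\<close>

definition wpn :: "nat \<Rightarrow> com \<Rightarrow> (state \<Rightarrow> bool) \<Rightarrow> state \<Rightarrow> bool" where
  "wpn n c Q s \<longleftrightarrow> (\<exists>t s'. exec c s t s' \<and> Q s' \<and>
     (mul_free c \<longrightarrow> (\<forall>W. bits_bound W s \<longrightarrow> bits_bound (W + n) s' \<and> t \<le> n * (W + n))))"

lemma wpn_mono:
  assumes "wpn n c Q s" "n \<le> n'"
  shows "wpn n' c Q s"
proof -
  obtain t s' where *: "exec c s t s'" "Q s'" "\<And>W. mul_free c \<Longrightarrow> bits_bound W s \<Longrightarrow>
     bits_bound (W + n) s' \<and> t \<le> n * (W + n)"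
    using assms(1) unfolding wpn_def by blast
  have "bits_bound (W + n') s' \<and> t \<le> n' * (W + n')" if "mul_free c" "bits_bound W s" for W
  proof
    show "bits_bound (W + n') s'"
      using *(3)[OF that] assms(2) by (auto elim: bits_bound_mono)
    have "n * (W + n) \<le> n' * (W + n')" using assms(2) by (intro mult_le_mono) auto
    then show "t \<le> n' * (W + n')" using *(3)[OF that] by linarith
  qed
  with *(1,2) show ?thesis unfolding wpn_def by blast
qed

section \<open>Proof rules with resource bounds\<close>

lemma wpn_Skip: "Q s \<Longrightarrow> wpn 1 SKIP Q s"
  unfolding wpn_def by (rule exI, rule exI, intro conjI, rule exec.Skip)
    (auto elim: bits_bound_mono)

lemma wpn_Assign:
  assumes "Q (s\<lparr>var := (var s)(x := aval e s)\<rparr>)"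
  shows "wpn (1 + exp_weight e) (Assign x e) Q s"
  unfolding wpn_def
proof (intro exI conjI impI allI)
  fix W assume *: "mul_free (Assign x e)" "bits_bound W s"
  then have "\<bar>aval e s\<bar> < 2 ^ (W + exp_weight e)" using abs_aval_less[of e W s] by simp
  also have "\<dots> \<le> 2 ^ (W + (1 + exp_weight e))" by (rule power_increasing) auto
  finally show "bits_bound (W + (1 + exp_weight e)) (s\<lparr>var := (var s)(x := aval e s)\<rparr>)"
    using bits_bound_mono[OF *(2), of "W + (1 + exp_weight e)"] by (auto simp: bits_bound_def)
  show "1 + acost e s \<le> (1 + exp_weight e) * (W + (1 + exp_weight e))"
    using acost_le[of e W s] * by (simp add: algebra_simps)
qed (rule exec.Assign, rule assms)

lemma wpn_Store:
  assumes "Q (s\<lparr>arr := (arr s)(a := (arr s a)(aval i s := aval e s))\<rparr>)"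
  shows "wpn (1 + exp_weight i + exp_weight e) (Store a i e) Q s"
  unfolding wpn_def
proof (intro exI conjI impI allI)
  fix W assume *: "mul_free (Store a i e)" "bits_bound W s"
  then have "\<bar>aval e s\<bar> < 2 ^ (W + exp_weight e)" using abs_aval_less[of e W s] by simp
  also have "\<dots> \<le> 2 ^ (W + (1 + exp_weight i + exp_weight e))" by (rule power_increasing) auto
  finally show "bits_bound (W + (1 + exp_weight i + exp_weight e))
      (s\<lparr>arr := (arr s)(a := (arr s a)(aval i s := aval e s))\<rparr>)"
    using bits_bound_mono[OF *(2), of "W + (1 + exp_weight i + exp_weight e)"]
    by (auto simp: bits_bound_def)
  show "1 + acost i s + acost e s \<le> (1 + exp_weight i + exp_weight e) * (W + (1 + exp_weight i + exp_weight e))"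
    using acost_le[of e W s] acost_le[of i W s] * by (simp add: algebra_simps)
qed (rule exec.Store, rule assms)

lemma wpn_Write:
  assumes "Q (s\<lparr>out_tape := out_tape s @ [aval e s]\<rparr>)"
  shows "wpn (1 + exp_weight e) (Write e) Q s"
  unfolding wpn_def
proof (intro exI conjI impI allI)
  fix W assume *: "mul_free (Write e)" "bits_bound W s"
  then have "\<bar>aval e s\<bar> < 2 ^ (W + exp_weight e)" using abs_aval_less[of e W s] by simp
  also have "\<dots> \<le> 2 ^ (W + (1 + exp_weight e))" by (rule power_increasing) auto
  finally show "bits_bound (W + (1 + exp_weight e)) (s\<lparr>out_tape := out_tape s @ [aval e s]\<rparr>)"
    using bits_bound_mono[OF *(2), of "W + (1 + exp_weight e)"] by (auto simp: bits_bound_def)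
  show "1 + acost e s \<le> (1 + exp_weight e) * (W + (1 + exp_weight e))"
    using acost_le[of e W s] * by (simp add: algebra_simps)
qed (rule exec.Write, rule assms)

lemma wpn_Seq:
  assumes "wpn x c (wpn y d Q) s"
  shows "wpn (1 + x + y) (Seq c d) Q s"
proof -
  obtain t s' where c: "exec c s t s'" "wpn y d Q s'" "mul_free c \<Longrightarrow> bits_bound W s \<Longrightarrow>
     bits_bound (W + x) s' \<and> t \<le> x * (W + x)" for W
    using assms unfolding wpn_def by blast
  then obtain t' s'' where d: "exec d s' t' s''" "Q s''" "mul_free d \<Longrightarrow> bits_bound W s' \<Longrightarrow>
     bits_bound (W + y) s'' \<and> t' \<le> y * (W + y)" for W
    unfolding wpn_def by blast
  show ?thesis
    unfolding wpn_def
  proof (intro exI conjI impI allI)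
    fix W assume *: "mul_free (Seq c d)" "bits_bound W s"
    with c(3)[of W] d(3)[of "W + x"]
    have **: "t \<le> x * (W + x)" "t' \<le> y * (W + x + y)" "bits_bound (W + x + y) s''" by auto
    then show "bits_bound (W + (1 + x + y)) s''" by (auto intro: bits_bound_mono)
    show "1 + t + t' \<le> (1 + x + y) * (W + (1 + x + y))"
      using budget_seq ** by blast
  qed (rule exec.Seq, fact+)
qed

text \<open>The budgets of both branches are added although only one branch runs: unlike a maximum,
  a sum keeps \<open>budget\<close> a polynomial.\<close>

lemma wpn_Cond:
  assumes "bval b s \<Longrightarrow> wpn x c Q s" "\<not> bval b s \<Longrightarrow> wpn y d Q s"
  shows "wpn (1 + bexp_weight b + x + y) (Cond b c d) Q s"
proof -
  have *: "wpn (x + y) (if bval b s then c else d) Q s"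
    using assms by (auto intro: wpn_mono)
  then obtain t s' where c: "exec (if bval b s then c else d) s t s'" "Q s'"
    "mul_free (if bval b s then c else d) \<Longrightarrow> bits_bound W s \<Longrightarrow>
     bits_bound (W + (x + y)) s' \<and> t \<le> (x + y) * (W + (x + y))" for W
    unfolding wpn_def by blast
  show ?thesis
    unfolding wpn_def
  proof (intro exI conjI impI allI)
    show "exec (Cond b c d) s (1 + bcost b s + t) s'"
      using c(1) exec.CondTrue[of b s c t s' d] exec.CondFalse[of b s d t s' c]
      by (cases "bval b s") auto
    fix W assume **: "mul_free (Cond b c d)" "bits_bound W s"
    then have 1: "bits_bound (W + (x + y)) s'" "t \<le> (x + y) * (W + (x + y))"
      "bcost b s \<le> bexp_weight b * (W + bexp_weight b)"
      using c(3)[of W] bcost_le by (auto split: if_splits)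
    then show "bits_bound (W + (1 + bexp_weight b + x + y)) s'" by (auto intro: bits_bound_mono)
    show "1 + bcost b s + t \<le> (1 + bexp_weight b + x + y) * (W + (1 + bexp_weight b + x + y))"
      using budget_seq[of "bcost b s" "bexp_weight b" W t "x + y"] 1
      by (simp add: algebra_simps)
  qed (rule c)
qed

lemma wpn_While_unfold:
  assumes "bval b s" "wpn x c (wpn y (While b c) Q) s"
  shows "wpn (1 + bexp_weight b + x + y) (While b c) Q s"
proof -
  obtain t s' where c: "exec c s t s'" "wpn y (While b c) Q s'" "mul_free c \<Longrightarrow> bits_bound W s \<Longrightarrow>
     bits_bound (W + x) s' \<and> t \<le> x * (W + x)" for W
    using assms unfolding wpn_def by blast
  then obtain t' s'' where d: "exec (While b c) s' t' s''" "Q s''"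
    "mul_free (While b c) \<Longrightarrow> bits_bound W s' \<Longrightarrow>
     bits_bound (W + y) s'' \<and> t' \<le> y * (W + y)" for W
    unfolding wpn_def by blast
  show ?thesis
    unfolding wpn_def
  proof (intro exI conjI impI allI)
    show "exec (While b c) s (1 + bcost b s + t + t') s''"
      by (rule exec.WhileTrue) fact+
    fix W assume *: "mul_free (While b c)" "bits_bound W s"
    with c(3)[of W] d(3)[of "W + x"] bcost_le[of b W s]
    have **: "t \<le> x * (W + x)" "t' \<le> y * (W + x + y)" "bits_bound (W + x + y) s''"
      "bcost b s \<le> bexp_weight b * (W + bexp_weight b)" by auto
    then show "bits_bound (W + (1 + bexp_weight b + x + y)) s''" by (auto intro: bits_bound_mono)
    show "1 + bcost b s + t + t' \<le> (1 + bexp_weight b + x + y) * (W + (1 + bexp_weight b + x + y))"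
      using ** by (simp add: algebra_simps)
  qed (rule d)
qed

lemma wpn_While_exit:
  assumes "\<not> bval b s" "Q s"
  shows "wpn (1 + bexp_weight b) (While b c) Q s"
  unfolding wpn_def
proof (intro exI conjI impI allI)
  show "exec (While b c) s (1 + bcost b s) s" by (rule exec.WhileFalse) fact
  fix W assume *: "mul_free (While b c)" "bits_bound W s"
  then show "bits_bound (W + (1 + bexp_weight b)) s"
    by (auto intro: bits_bound_mono)
  show "1 + bcost b s \<le> (1 + bexp_weight b) * (W + (1 + bexp_weight b))"
    using bcost_le[of b W s] * by simp
qed (rule assms)

subsection \<open>Frames\<close>

fun written_vars :: "com \<Rightarrow> vname set" where
  "written_vars (Assign x e) = {x}"
| "written_vars (Seq c d) = written_vars c \<union> written_vars d"
| "written_vars (Cond b c d) = written_vars c \<union> written_vars d"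
| "written_vars (While b c) = written_vars c"
| "written_vars _ = {}"

fun written_arrs :: "com \<Rightarrow> vname set" where
  "written_arrs (Store a i e) = {a}"
| "written_arrs (Seq c d) = written_arrs c \<union> written_arrs d"
| "written_arrs (Cond b c d) = written_arrs c \<union> written_arrs d"
| "written_arrs (While b c) = written_arrs c"
| "written_arrs _ = {}"

fun silent :: "com \<Rightarrow> bool" where
  "silent (Write e) = False"
| "silent (Seq c d) = (silent c \<and> silent d)"
| "silent (Cond b c d) = (silent c \<and> silent d)"
| "silent (While b c) = silent c"
| "silent _ = True"

definition frame :: "com \<Rightarrow> state \<Rightarrow> state \<Rightarrow> bool" where
  "frame c s s' \<longleftrightarrow> (\<forall>x. x \<notin> written_vars c \<longrightarrow> var s' x = var s x) \<and>
     (\<forall>a. a \<notin> written_arrs c \<longrightarrow> arr s' a = arr s a) \<and> (silent c \<longrightarrow> out_tape s' = out_tape s)"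

lemma frame_var: "frame c s s' \<Longrightarrow> x \<notin> written_vars c \<Longrightarrow> var s' x = var s x"
  and frame_arr: "frame c s s' \<Longrightarrow> a \<notin> written_arrs c \<Longrightarrow> arr s' a = arr s a"
  and frame_out: "frame c s s' \<Longrightarrow> silent c \<Longrightarrow> out_tape s' = out_tape s"
  by (simp_all add: frame_def)

lemma exec_frame: "exec c s t s' \<Longrightarrow> frame c s s'"
  by (induction rule: exec.induct) (auto simp: frame_def)

lemma frame_refl: "frame c s s"
  by (simp add: frame_def)

lemma frame_trans: "frame c s s' \<Longrightarrow> frame c s' s'' \<Longrightarrow> frame c s s''"
  by (simp add: frame_def)

text \<open>Handing the frame to the consequence rule lets specifications mention only what a
  command changes; the rest is recovered from the syntactic sets of written names.\<close>

lemma wpn_conseq: "wpn n c Q s \<Longrightarrow> (\<And>s'. frame c s s' \<Longrightarrow> Q s' \<Longrightarrow> Q' s') \<Longrightarrow> wpn n c Q' s"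
  unfolding wpn_def using exec_frame by blast

subsection \<open>Programs whose loops are bounded by a common number of iterations\<close>

text \<open>The budget of a program all of whose loops iterate at most \<open>R\<close> times, each time they are
  entered, as a polynomial in \<open>R\<close>.\<close>

fun budget :: "com \<Rightarrow> nat poly" where
  "budget SKIP = 1"
| "budget (Assign x e) = [:1 + exp_weight e:]"
| "budget (Store a i e) = [:1 + exp_weight i + exp_weight e:]"
| "budget (Write e) = [:1 + exp_weight e:]"
| "budget (Seq c d) = 1 + budget c + budget d"
| "budget (Cond b c d) = [:1 + bexp_weight b:] + budget c + budget d"
| "budget (While b c) = [:1, 1:] * ([:1 + bexp_weight b:] + budget c)"

definition wp :: "nat \<Rightarrow> com \<Rightarrow> (state \<Rightarrow> bool) \<Rightarrow> state \<Rightarrow> bool" where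
  "wp R c = wpn (poly (budget c) R) c"

lemma wp_conseq: "wp R c Q s \<Longrightarrow> (\<And>s'. frame c s s' \<Longrightarrow> Q s' \<Longrightarrow> Q' s') \<Longrightarrow> wp R c Q' s"
  unfolding wp_def by (rule wpn_conseq)

lemma wp_Skip: "Q s \<Longrightarrow> wp R SKIP Q s"
  unfolding wp_def using wpn_Skip by simp

lemma wp_Assign: "Q (s\<lparr>var := (var s)(x := aval e s)\<rparr>) \<Longrightarrow> wp R (Assign x e) Q s"
  unfolding wp_def using wpn_Assign by simp

lemma wp_Store:
  "Q (s\<lparr>arr := (arr s)(a := (arr s a)(aval i s := aval e s))\<rparr>) \<Longrightarrow> wp R (Store a i e) Q s"
  unfolding wp_def using wpn_Store by simp

lemma wp_Write: "Q (s\<lparr>out_tape := out_tape s @ [aval e s]\<rparr>) \<Longrightarrow> wp R (Write e) Q s"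
  unfolding wp_def using wpn_Write by simp

lemma wp_Seq: "wp R c (wp R d Q) s \<Longrightarrow> wp R (Seq c d) Q s"
  unfolding wp_def using wpn_Seq by simp

lemma wp_Cond:
  "(bval b s \<Longrightarrow> wp R c Q s) \<Longrightarrow> (\<not> bval b s \<Longrightarrow> wp R d Q s) \<Longrightarrow> wp R (Cond b c d) Q s"
  unfolding wp_def using wpn_Cond[of b s "poly (budget c) R" c Q "poly (budget d) R" d] by simp

lemmas wp_intros = wp_Skip wp_Assign wp_Store wp_Write wp_Seq wp_Cond

text \<open>The natural number \<open>k\<close> in the invariant bounds the number of remaining iterations.\<close>

lemma wp_While:
  assumes init: "I k s" "k \<le> R"
    and step: "\<And>k s'. frame c s s' \<Longrightarrow> I k s' \<Longrightarrow> bval b s' \<Longrightarrow> wp R c (\<lambda>s''. \<exists>k'<k. I k' s'') s'"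
    and exit: "\<And>k s'. frame c s s' \<Longrightarrow> I k s' \<Longrightarrow> \<not> bval b s' \<Longrightarrow> Q s'"
  shows "wp R (While b c) Q s"
proof -
  let ?A = "1 + bexp_weight b + poly (budget c) R"
  \<comment> \<open>\<open>?A\<close> pays for one test and one run of the body; the additional unit
    in \<open>k + 1\<close> pays for the last test, which fails.\<close>
  have "wpn ((k + 1) * ?A) (While b c) Q s'" if "I k s'" "frame c s s'" for k s'
    using that
  proof (induction k arbitrary: s' rule: less_induct)
    case (less k)
    show ?case
    proof (cases "bval b s'")
      case True
      have "wpn (poly (budget c) R) c (\<lambda>s''. \<exists>k'<k. I k' s'') s'"
        using step[OF less.prems(2,1) True] unfolding wp_def .
      then have "wpn (poly (budget c) R) c (wpn (k * ?A) (While b c) Q) s'"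
      proof (rule wpn_conseq)
        fix s'' assume "frame c s' s''" "\<exists>k'<k. I k' s''"
        then obtain k' where "k' < k" "I k' s''" "frame c s s''"
          using less.prems(2) frame_trans by blast
        then have "wpn ((k' + 1) * ?A) (While b c) Q s''" using less.IH by blast
        moreover have "(k' + 1) * ?A \<le> k * ?A" using \<open>k' < k\<close>
          by (intro mult_le_mono1) simp
        ultimately show "wpn (k * ?A) (While b c) Q s''" by (rule wpn_mono)
      qed
      from wpn_While_unfold[OF True this] show ?thesis by (simp add: algebra_simps)
    next
      case False
      have "wpn (1 + bexp_weight b) (While b c) Q s'"
        using exit[OF less.prems(2,1) False] False by (intro wpn_While_exit)
      then show ?thesis by (rule wpn_mono) simp
    qed
  qed
  then have "wpn ((k + 1) * ?A) (While b c) Q s" using init frame_refl by blast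
  moreover have "(k + 1) * ?A \<le> (R + 1) * ?A" using init by (intro mult_le_mono1) simp
  ultimately have "wpn ((R + 1) * ?A) (While b c) Q s" by (rule wpn_mono)
  then show ?thesis unfolding wp_def by (simp add: algebra_simps)
qed

definition For :: "vname \<Rightarrow> vname \<Rightarrow> com \<Rightarrow> com" where
  "For i h c = Seq (Assign i (N 0)) (While (Less (V i) (V h)) (Seq c (Assign i (Add (V i) (N 1)))))"

lemma written_For [simp]:
  "written_vars (For i h c) = insert i (written_vars c)" "written_arrs (For i h c) = written_arrs c"
  "silent (For i h c) = silent c" "mul_free (For i h c) = mul_free c"
  by (auto simp: For_def)

text \<open>The step is verified with the counter already advanced, so it leads directly from
  \<open>I j\<close> to \<open>I (j + 1)\<close>. As the body writes neither the counter nor its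
  limit, \<open>n\<close> minus the counter serves as the measure for
  \<open>wp_While\<close>.\<close>

lemma wp_For:
  assumes h: "h \<notin> written_vars c" "h \<noteq> i" "i \<notin> written_vars c"
    and n: "var s h = n" "0 \<le> n" "n \<le> int R"
    and init: "I 0 (s\<lparr>var := (var s)(i := 0)\<rparr>)"
    and step: "\<And>j s'. frame (For i h c) s s' \<Longrightarrow> I j s' \<Longrightarrow> var s' i = j \<Longrightarrow> 0 \<le> j \<Longrightarrow> j < n \<Longrightarrow>
      wp R c (\<lambda>s''. I (j + 1) (s''\<lparr>var := (var s'')(i := j + 1)\<rparr>)) s'"
    and exit: "\<And>s'. frame (For i h c) s s' \<Longrightarrow> I n s' \<Longrightarrow> var s' i = n \<Longrightarrow> Q s'"
  shows "wp R (For i h c) Q s"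
  unfolding For_def
proof (intro wp_Seq wp_Assign)
  define s0 where "s0 = s\<lparr>var := (var s)(i := aval (N 0) s)\<rparr>"
  let ?J = "\<lambda>k s'. 0 \<le> var s' i \<and> int k + var s' i = n \<and> I (var s' i) s'"
  have fr: "frame (For i h c) s s'" if "frame (Seq c (Assign i (Add (V i) (N 1)))) s0 s'" for s'
    using that unfolding frame_def s0_def by auto
  show "wp R (While (Less (V i) (V h)) (Seq c (Assign i (Add (V i) (N 1))))) Q s0"
  proof (rule wp_While[where I = ?J and k = "nat n"])
    show "?J (nat n) s0" "nat n \<le> R" using n init by (auto simp: s0_def)
  next
    fix k s' assume f: "frame (Seq c (Assign i (Add (V i) (N 1)))) s0 s'" and J: "?J k s'"
      and b: "bval (Less (V i) (V h)) s'"
    have h': "var s' h = n" using frame_var[OF fr[OF f], of h] h n by simp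
    show "wp R (Seq c (Assign i (Add (V i) (N 1)))) (\<lambda>s''. \<exists>k'<k. ?J k' s'') s'"
    proof (rule wp_Seq, rule wp_conseq[OF step[OF fr[OF f], of "var s' i"]])
      fix s'' assume f2: "frame c s' s''"
        and *: "I (var s' i + 1) (s''\<lparr>var := (var s'')(i := var s' i + 1)\<rparr>)"
      have "var s'' i = var s' i" using frame_var[OF f2 h(3)] .
      then show "wp R (Assign i (Add (V i) (N 1))) (\<lambda>s''. \<exists>k'<k. ?J k' s'') s''"
        using * J b h' by (intro wp_Assign exI[of _ "k - 1"]) auto
    qed (use J b h' in auto)
  next
    fix k s' assume f: "frame (Seq c (Assign i (Add (V i) (N 1)))) s0 s'" and J: "?J k s'"
      and b: "\<not> bval (Less (V i) (V h)) s'"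
    have h': "var s' h = n" using frame_var[OF fr[OF f], of h] h n by simp
    then have "var s' i = n" using J b by simp
    then show "Q s'" using exit[OF fr[OF f]] J by simp
  qed
qed

section \<open>From loop bounds to polynomial time\<close>

lemma length_le_input_size: "length xs \<le> input_size xs"
  by (induction xs) (auto simp: input_size_def int_size_def)

lemma bits_bound_init: "bits_bound (input_size xs) (init_state xs)"
proof -
  have 1: "\<bar>xs ! i\<bar> < 2 ^ input_size xs" if "i < length xs" for i
  proof -
    have "int_size (xs ! i) \<le> input_size xs"
      unfolding input_size_def using that by (intro member_le_sum_list) auto
    then have "(2::int) ^ (int_size (xs ! i) - 1) \<le> 2 ^ input_size xs"
      by (intro power_increasing) auto
    then show ?thesis using abs_less_int_size[of "xs ! i"] by linarith
  qed
  have "length xs \<le> input_size xs"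
    by (rule length_le_input_size)
  then have "int (length xs) < 2 ^ input_size xs"
    by (metis less_exp less_le_trans le_less_trans of_nat_less_iff of_nat_numeral of_nat_power)
  then show ?thesis using 1 unfolding bits_bound_def init_state_def by auto
qed

text \<open>Initially no number has more bits than the whole input, so \<open>W\<close> can be the
  input size \<open>z\<close>. A loop bound that is polynomial in \<open>z\<close> makes the budget
  a polynomial \<open>q\<close> in \<open>z\<close> as well, and \<open>q * (z + q)\<close> is the
  time bound.\<close>

lemma poly_time_computableI:
  assumes "mul_free c"
    and "\<And>I. I \<in> Inst \<Longrightarrow>
      wp (poly r (input_size (enc I))) c (\<lambda>s. ans I (out_tape s)) (init_state (enc I))"
  shows "poly_time_computable Inst enc ans"
  unfolding poly_time_computable_def
proof (rule exI, rule exI, rule ballI)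
  fix I assume "I \<in> Inst"
  let ?q = "pcompose (budget c) r"
  let ?z = "input_size (enc I)"
  from assms(2)[OF \<open>I \<in> Inst\<close>] obtain t s where
    "exec c (init_state (enc I)) t s" "ans I (out_tape s)"
    "t \<le> poly ?q ?z * (?z + poly ?q ?z)"
    unfolding wp_def wpn_def poly_pcompose using assms(1) bits_bound_init by blast
  then show "\<exists>t s. exec c (init_state (enc I)) t s \<and>
       t \<le> poly (?q * ([:0, 1:] + ?q)) ?z \<and> ans I (out_tape s)"
    by (intro exI[of _ t] exI[of _ s]) simp
qed

section \<open>Circulations and the kilter conditions\<close>

text \<open>Nodes and arcs are integers and the data are total functions on the integers, so the
  locale applies directly to the contents of program arrays.\<close>

locale network =
  fixes n K :: int and T H W :: "int \<Rightarrow> int"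
  assumes n_nonneg: "0 \<le> n" and K_nonneg: "0 \<le> K"
    and T_range: "\<And>a. 0 \<le> a \<Longrightarrow> a < K \<Longrightarrow> 0 \<le> T a \<and> T a < n"
    and H_range: "\<And>a. 0 \<le> a \<Longrightarrow> a < K \<Longrightarrow> 0 \<le> H a \<and> H a < n"
begin

definition rcost :: "(int \<Rightarrow> int) \<Rightarrow> int \<Rightarrow> int" where
  "rcost p a = W a + p (T a) - p (H a)"

definition excess :: "(int \<Rightarrow> int) \<Rightarrow> int \<Rightarrow> int" where
  "excess f v = (\<Sum>a\<in>{0..<K}. f a * (of_bool (H a = v) - of_bool (T a = v)))"

text \<open>Complementary slackness for circulations: every residual arc, used forwards or
  backwards, has nonnegative reduced cost.\<close>

definition kilter :: "(int \<Rightarrow> int) \<Rightarrow> (int \<Rightarrow> int) \<Rightarrow> (int \<Rightarrow> int) \<Rightarrow> bool" where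
  "kilter p cap f \<longleftrightarrow> (\<forall>a. 0 \<le> a \<and> a < K \<longrightarrow> 0 \<le> f a \<and> f a \<le> cap a \<and>
     (f a < cap a \<longrightarrow> 0 \<le> rcost p a) \<and> (0 < f a \<longrightarrow> rcost p a \<le> 0))"

section \<open>The kilter conditions certify optimality\<close>

lemma sum_potential_difference:
  "(\<Sum>a\<in>{0..<K}. h a * (p (T a) - p (H a))) = - (\<Sum>v\<in>{0..<n}. p v * excess h v)"
proof -
  have "(\<Sum>v\<in>{0..<n}. p v * excess h v) =
      (\<Sum>v\<in>{0..<n}. \<Sum>a\<in>{0..<K}. p v * (h a * (of_bool (H a = v) - of_bool (T a = v))))"
    by (simp add: excess_def sum_distrib_left)
  also have "\<dots> = (\<Sum>a\<in>{0..<K}. \<Sum>v\<in>{0..<n}. p v * (h a * (of_bool (H a = v) - of_bool (T a = v))))"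
    by (rule sum.swap)
  also have "\<dots> = (\<Sum>a\<in>{0..<K}. h a * (p (H a) - p (T a)))"
  proof (rule sum.cong)
    fix a assume a: "a \<in> {0..<K}"
    have 1: "(\<Sum>v\<in>{0..<n}. p v * of_bool (H a = v)) = p (H a)"
      using H_range[of a] a by (subst sum.remove[of _ "H a"]) auto
    have 2: "(\<Sum>v\<in>{0..<n}. p v * of_bool (T a = v)) = p (T a)"
      using T_range[of a] a by (subst sum.remove[of _ "T a"]) auto
    have "(\<Sum>v\<in>{0..<n}. p v * (h a * (of_bool (H a = v) - of_bool (T a = v)))) =
        h a * ((\<Sum>v\<in>{0..<n}. p v * of_bool (H a = v)) - (\<Sum>v\<in>{0..<n}. p v * of_bool (T a = v)))"
      by (simp only: sum_distrib_left sum_subtractf[symmetric]) (rule sum.cong, auto simp: algebra_simps)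
    then show "(\<Sum>v\<in>{0..<n}. p v * (h a * (of_bool (H a = v) - of_bool (T a = v)))) =
        h a * (p (H a) - p (T a))"
      unfolding 1 2 .
  qed simp
  finally show ?thesis
    by (simp add: sum_negf[symmetric] algebra_simps)
qed

text \<open>Replacing costs by reduced costs does not change the cost difference of two
  circulations, because the potentials cancel at every node. Arc by arc,
  \<open>(g - f) * rcost\<close> is nonnegative: \<open>f\<close> is at capacity where the reduced
  cost is negative and 0 where it is positive.\<close>

lemma kilter_optimal:
  assumes k: "kilter p cap f" and f: "\<And>v. excess f v = 0" and g: "\<And>v. excess g v = 0"
    and cap: "\<And>a. 0 \<le> a \<Longrightarrow> a < K \<Longrightarrow> 0 \<le> g a \<and> g a \<le> cap a"
  shows "(\<Sum>a\<in>{0..<K}. W a * f a) \<le> (\<Sum>a\<in>{0..<K}. W a * g a)"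
proof -
  let ?h = "\<lambda>a. g a - f a"
  have "excess ?h v = excess g v - excess f v" for v
    unfolding excess_def sum_subtractf[symmetric] by (rule sum.cong) (auto simp: algebra_simps)
  then have "(\<Sum>a\<in>{0..<K}. ?h a * (p (T a) - p (H a))) = 0"
    using f g by (subst sum_potential_difference) simp
  moreover have "0 \<le> (\<Sum>a\<in>{0..<K}. ?h a * rcost p a)"
  proof (rule sum_nonneg)
    fix a assume "a \<in> {0..<K}"
    then have *: "0 \<le> f a \<and> f a \<le> cap a \<and> (f a < cap a \<longrightarrow> 0 \<le> rcost p a) \<and> (0 < f a \<longrightarrow> rcost p a \<le> 0)"
      "0 \<le> g a \<and> g a \<le> cap a"
      using k cap by (auto simp: kilter_def)
    show "0 \<le> ?h a * rcost p a"
    proof (cases "rcost p a" "0::int" rule: linorder_cases)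
      case less
      then have "?h a \<le> 0" using * by linarith
      then show ?thesis using less by (simp add: mult_nonpos_nonpos)
    next
      case greater
      then have "?h a \<ge> 0" using * by linarith
      then show ?thesis using greater by simp
    qed simp
  qed
  moreover have "(\<Sum>a\<in>{0..<K}. ?h a * rcost p a) = (\<Sum>a\<in>{0..<K}. W a * g a) - (\<Sum>a\<in>{0..<K}. W a * f a)
     + (\<Sum>a\<in>{0..<K}. ?h a * (p (T a) - p (H a)))"
    unfolding sum_subtractf[symmetric] sum.distrib[symmetric] rcost_def
    by (rule sum.cong) (auto simp: algebra_simps)
  ultimately show ?thesis by linarith
qed

section \<open>Changes of flow, potentials and tree\<close>

lemma excess_upd:
  assumes "0 \<le> a" "a < K"
  shows "excess (f(a := f a + d)) v = excess f v + d * (of_bool (H a = v) - of_bool (T a = v))"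
proof -
  have "excess (f(a := f a + d)) v = (\<Sum>x\<in>{0..<K}. f x * (of_bool (H x = v) - of_bool (T x = v)) +
      (if x = a then d * (of_bool (H a = v) - of_bool (T a = v)) else 0))"
    unfolding excess_def by (rule sum.cong) (auto simp: algebra_simps)
  then show ?thesis using assms by (simp add: sum.distrib excess_def)
qed

lemma excess_double: "excess (\<lambda>a. 2 * f a) v = 2 * excess f v"
  unfolding excess_def sum_distrib_left by (rule sum.cong) auto

lemma excess_cong: "(\<And>a. 0 \<le> a \<Longrightarrow> a < K \<Longrightarrow> f a = g a) \<Longrightarrow> excess f v = excess g v"
  unfolding excess_def by (rule sum.cong) auto

text \<open>The range guards mirror the loop of \<open>raise_potentials\<close>, which leaves array
  entries outside the nodes alone.\<close>

definition shift :: "(int \<Rightarrow> int) \<Rightarrow> int \<Rightarrow> (int \<Rightarrow> int) \<Rightarrow> int \<Rightarrow> int" where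
  "shift lab d p x = (if 0 \<le> x \<and> x < n \<and> lab x < 1 then p x + d else p x)"

text \<open>\<open>d\<close> is at most the slack of every residual arc among the first \<open>j\<close> that leaves the set of
  labelled nodes, where an arc carrying flow is also residual against its direction.\<close>

definition slack_bound ::
  "(int \<Rightarrow> int) \<Rightarrow> (int \<Rightarrow> int) \<Rightarrow> (int \<Rightarrow> int) \<Rightarrow> (int \<Rightarrow> int) \<Rightarrow> int \<Rightarrow> int \<Rightarrow> bool" where
  "slack_bound p cap f lab j d \<longleftrightarrow> (\<forall>a. 0 \<le> a \<and> a < j \<longrightarrow>
     (0 < lab (T a) \<and> lab (H a) < 1 \<and> f a < cap a \<longrightarrow> d \<le> rcost p a) \<and>
     (0 < lab (H a) \<and> lab (T a) < 1 \<and> 0 < f a \<longrightarrow> d \<le> - rcost p a))"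

text \<open>Describes the arc \<open>b\<close> that the scan selects: it attains the slack
  \<open>d\<close>, and \<open>y\<close> is its end not yet reached. Once the shift by
  \<open>d\<close> has made it tight, it becomes the tree arc of \<open>y\<close>.\<close>

definition leaves ::
  "(int \<Rightarrow> int) \<Rightarrow> (int \<Rightarrow> int) \<Rightarrow> (int \<Rightarrow> int) \<Rightarrow> (int \<Rightarrow> int) \<Rightarrow> int \<Rightarrow> int \<Rightarrow> int \<Rightarrow> bool" where
  "leaves p cap f lab d b y \<longleftrightarrow> 0 \<le> b \<and> b < K \<and> lab y < 1 \<and>
     (H b = y \<and> 0 < lab (T b) \<and> f b < cap b \<and> rcost p b = d \<or>
      T b = y \<and> 0 < lab (H b) \<and> 0 < f b \<and> - rcost p b = d)"

text \<open>Labels number the nodes in the order in which they are reached. The tight residual arc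
  \<open>P y\<close> connects \<open>y\<close> to a node with a smaller label.\<close>

definition tree ::
  "(int \<Rightarrow> int) \<Rightarrow> (int \<Rightarrow> int) \<Rightarrow> (int \<Rightarrow> int) \<Rightarrow> (int \<Rightarrow> int) \<Rightarrow> (int \<Rightarrow> int) \<Rightarrow> int \<Rightarrow> int \<Rightarrow> bool" where
  "tree p cap f lab P v k \<longleftrightarrow> (\<forall>y. 0 \<le> y \<and> y < n \<and> 0 < lab y \<and> lab y \<le> k \<and> y \<noteq> v \<longrightarrow>
     0 \<le> P y \<and> P y < K \<and> rcost p (P y) = 0 \<and>
     (H (P y) = y \<and> f (P y) < cap (P y) \<and> 0 < lab (T (P y)) \<and> lab (T (P y)) < lab y \<or>
      T (P y) = y \<and> 0 < f (P y) \<and> 0 < lab (H (P y)) \<and> lab (H (P y)) < lab y))"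

lemma rcost_shift:
  "0 \<le> a \<Longrightarrow> a < K \<Longrightarrow> rcost (shift lab d p) a =
     rcost p a + (if lab (T a) < 1 then d else 0) - (if lab (H a) < 1 then d else 0)"
  using T_range[of a] H_range[of a] by (simp add: rcost_def shift_def)

text \<open>Only arcs with exactly one labelled end change their reduced cost. Among residual arcs,
  those leaving the labelled set get cheaper by \<open>d\<close>, which \<open>slack_bound\<close>
  allows; those entering it get dearer, which does no harm.\<close>

lemma kilter_shift:
  assumes "kilter p cap f" "0 \<le> d" "slack_bound p cap f lab K d"
  shows "kilter (shift lab d p) cap f"
  unfolding kilter_def
proof (intro allI impI)
  fix a assume a: "0 \<le> a \<and> a < K"
  then have "0 \<le> f a \<and> f a \<le> cap a \<and> (f a < cap a \<longrightarrow> 0 \<le> rcost p a) \<and> (0 < f a \<longrightarrow> rcost p a \<le> 0)"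
    "(0 < lab (T a) \<and> lab (H a) < 1 \<and> f a < cap a \<longrightarrow> d \<le> rcost p a) \<and>
     (0 < lab (H a) \<and> lab (T a) < 1 \<and> 0 < f a \<longrightarrow> d \<le> - rcost p a)"
    using assms by (auto simp: kilter_def slack_bound_def)
  then show "0 \<le> f a \<and> f a \<le> cap a \<and> (f a < cap a \<longrightarrow> 0 \<le> rcost (shift lab d p) a) \<and>
      (0 < f a \<longrightarrow> rcost (shift lab d p) a \<le> 0)"
    using assms(2) a by (simp add: rcost_shift) linarith
qed

text \<open>Both ends of a tree arc are labelled, so its reduced cost stays 0.\<close>

lemma tree_shift:
  assumes "tree p cap f lab P v k"
  shows "tree (shift lab d p) cap f lab P v k"
  unfolding tree_def
proof (intro allI impI)
  fix y assume y: "0 \<le> y \<and> y < n \<and> 0 < lab y \<and> lab y \<le> k \<and> y \<noteq> v"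
  then have *: "0 \<le> P y \<and> P y < K \<and> rcost p (P y) = 0 \<and>
     (H (P y) = y \<and> f (P y) < cap (P y) \<and> 0 < lab (T (P y)) \<and> lab (T (P y)) < lab y \<or>
      T (P y) = y \<and> 0 < f (P y) \<and> 0 < lab (H (P y)) \<and> lab (H (P y)) < lab y)"
    using assms unfolding tree_def by blast
  then have "0 < lab (T (P y)) \<and> 0 < lab (H (P y))" using y by auto
  then have "rcost (shift lab d p) (P y) = 0" using * by (simp add: rcost_shift)
  with * show "0 \<le> P y \<and> P y < K \<and> rcost (shift lab d p) (P y) = 0 \<and>
     (H (P y) = y \<and> f (P y) < cap (P y) \<and> 0 < lab (T (P y)) \<and> lab (T (P y)) < lab y \<or>
      T (P y) = y \<and> 0 < f (P y) \<and> 0 < lab (H (P y)) \<and> lab (H (P y)) < lab y)"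
    by blast
qed

text \<open>The new label exceeds all existing ones, so the other end of \<open>b\<close> has a
  smaller label than \<open>y\<close>. Older tree arcs join labelled nodes and therefore avoid
  \<open>y\<close>, which had no label.\<close>

lemma tree_grow:
  assumes t: "tree p cap f lab P v k" and lv: "0 < lab v"
    and lab: "\<And>x. 0 \<le> x \<Longrightarrow> x < n \<Longrightarrow> lab x \<le> k" and b: "leaves p cap f lab 0 b y"
  shows "tree p cap f (lab(y := k + 1)) (P(y := b)) v (k + 1)"
  unfolding tree_def
proof (intro allI impI)
  fix z assume z: "0 \<le> z \<and> z < n \<and> 0 < (lab(y := k + 1)) z \<and> (lab(y := k + 1)) z \<le> k + 1 \<and> z \<noteq> v"
  have b': "0 \<le> b" "b < K" "lab y < 1" using b by (auto simp: leaves_def)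
  show "0 \<le> (P(y := b)) z \<and> (P(y := b)) z < K \<and> rcost p ((P(y := b)) z) = 0 \<and>
     (H ((P(y := b)) z) = z \<and> f ((P(y := b)) z) < cap ((P(y := b)) z) \<and> 0 < (lab(y := k + 1)) (T ((P(y := b)) z)) \<and> (lab(y := k + 1)) (T ((P(y := b)) z)) < (lab(y := k + 1)) z \<or>
      T ((P(y := b)) z) = z \<and> 0 < f ((P(y := b)) z) \<and> 0 < (lab(y := k + 1)) (H ((P(y := b)) z)) \<and> (lab(y := k + 1)) (H ((P(y := b)) z)) < (lab(y := k + 1)) z)"
  proof (cases "z = y")
    case True
    have "lab (T b) \<le> k" "lab (H b) \<le> k" using lab T_range H_range b' by auto
    with True b show ?thesis by (auto simp: leaves_def)
  next
    case False
    then have *: "0 \<le> P z \<and> P z < K \<and> rcost p (P z) = 0 \<and>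
     (H (P z) = z \<and> f (P z) < cap (P z) \<and> 0 < lab (T (P z)) \<and> lab (T (P z)) < lab z \<or>
      T (P z) = z \<and> 0 < f (P z) \<and> 0 < lab (H (P z)) \<and> lab (H (P z)) < lab z)"
      using t z lab unfolding tree_def by auto
    have "0 < lab x \<Longrightarrow> x \<noteq> y" for x using b' by auto
    with * False show ?thesis by auto
  qed
qed

lemma leaves_shift:
  assumes "leaves p cap f lab d b y"
  shows "leaves (shift lab d p) cap f lab 0 b y"
  using assms by (auto simp: leaves_def rcost_shift)

text \<open>One step of the augmentation along a tree path. Only the arc \<open>P y\<close> changes its flow, and it
  is not a tree arc of any node with a label smaller than that of \<open>y\<close>.\<close>

lemma augment_step:
  assumes k: "kilter p cap f" and t: "tree p cap f lab P v (lab y)"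
    and y: "0 \<le> y" "y < n" "0 < lab y" "y \<noteq> v"
    and ex: "\<And>z. excess f z = of_bool (z = v) - of_bool (z = y)"
    and d: "(d, y') = (if H (P y) = y then (1, T (P y)) else (-1, H (P y)))"
    and f': "f' = f(P y := f (P y) + d)"
  shows "kilter p cap f'" "tree p cap f' lab P v (lab y')" "0 \<le> y'" "y' < n" "0 < lab y'"
    "lab y' < lab y" "excess f' z = of_bool (z = v) - of_bool (z = y')"
proof -
  have P: "0 \<le> P y \<and> P y < K \<and> rcost p (P y) = 0 \<and>
     (H (P y) = y \<and> f (P y) < cap (P y) \<and> 0 < lab (T (P y)) \<and> lab (T (P y)) < lab y \<or>
      T (P y) = y \<and> 0 < f (P y) \<and> 0 < lab (H (P y)) \<and> lab (H (P y)) < lab y)"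
    using t y unfolding tree_def by blast
  show "0 \<le> y'" "y' < n" "0 < lab y'" and less: "lab y' < lab y"
    using P d T_range[of "P y"] H_range[of "P y"] by (auto split: if_splits)
  show "excess f' z = of_bool (z = v) - of_bool (z = y')"
    using P d ex[of z] unfolding f' by (auto simp: excess_upd split: if_splits)
  show "kilter p cap f'"
    using k P d unfolding f' kilter_def by (auto split: if_splits)
  show "tree p cap f' lab P v (lab y')"
    unfolding tree_def
  proof (intro allI impI)
    fix z assume z: "0 \<le> z \<and> z < n \<and> 0 < lab z \<and> lab z \<le> lab y' \<and> z \<noteq> v"
    then have *: "0 \<le> P z \<and> P z < K \<and> rcost p (P z) = 0 \<and>
     (H (P z) = z \<and> f (P z) < cap (P z) \<and> 0 < lab (T (P z)) \<and> lab (T (P z)) < lab z \<or>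
      T (P z) = z \<and> 0 < f (P z) \<and> 0 < lab (H (P z)) \<and> lab (H (P z)) < lab z)"
      using t less unfolding tree_def by auto
    \<comment> \<open>Both ends of \<open>P z\<close> have labels at most \<open>lab z\<close>,
      below that of \<open>y\<close>, whereas \<open>P y\<close> touches \<open>y\<close>.\<close>
    then have "T (P z) \<noteq> y" "H (P z) \<noteq> y" using z less by auto
    moreover have "T (P y) = y \<or> H (P y) = y" using P by auto
    ultimately have "P z \<noteq> P y" by auto
    then show "0 \<le> P z \<and> P z < K \<and> rcost p (P z) = 0 \<and>
     (H (P z) = z \<and> f' (P z) < cap (P z) \<and> 0 < lab (T (P z)) \<and> lab (T (P z)) < lab z \<or>
      T (P z) = z \<and> 0 < f' (P z) \<and> 0 < lab (H (P z)) \<and> lab (H (P z)) < lab z)"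
      using * unfolding f' by simp
  qed
qed

end

lemma div_double_cases:
  fixes c q :: int
  assumes "0 < q"
  shows "c div q = 2 * (c div (2 * q)) \<or> c div q = 2 * (c div (2 * q)) + 1"
proof -
  have "c div (2 * q) = (c div q) div 2"
    using assms by (simp add: zdiv_zmult2_eq mult.commute)
  then show ?thesis by linarith
qed

section \<open>The scaling algorithm\<close>

notation Seq (infixr ";;" 60)
notation Assign (infix "::=" 61)

abbreviation Eq :: "aexp \<Rightarrow> aexp \<Rightarrow> bexp" where
  "Eq e f \<equiv> Conj (Neg (Less e f)) (Neg (Less f e))"

definition rcost_exp :: "aexp \<Rightarrow> aexp" where
  "rcost_exp a = Sub (Add (Idx ''W'' a) (Idx ''pi'' (Idx ''T'' a))) (Idx ''pi'' (Idx ''H'' a))"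

definition clear :: com where
  "clear = For ''i'' ''n'' (Store ''lab'' (V ''i'') (N 0))"

definition scan_arc :: com where
  "scan_arc =
    ''r'' ::= rcost_exp (V ''a'');;
    Cond (Conj (Conj (Less (N 0) (Idx ''lab'' (Idx ''T'' (V ''a''))))
                     (Less (Idx ''lab'' (Idx ''H'' (V ''a''))) (N 1)))
               (Conj (Less (Idx ''f'' (V ''a'')) (Idx ''cap'' (V ''a''))) (Less (V ''r'') (V ''d''))))
      (''d'' ::= V ''r'';; ''b'' ::= V ''a'';; ''y'' ::= Idx ''H'' (V ''a''))
      (Cond (Conj (Conj (Less (N 0) (Idx ''lab'' (Idx ''H'' (V ''a''))))
                        (Less (Idx ''lab'' (Idx ''T'' (V ''a''))) (N 1)))
                  (Conj (Less (N 0) (Idx ''f'' (V ''a''))) (Less (Sub (N 0) (V ''r'')) (V ''d''))))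
        (''d'' ::= Sub (N 0) (V ''r'');; ''b'' ::= V ''a'';; ''y'' ::= Idx ''T'' (V ''a''))
        SKIP)"

text \<open>The initial \<open>d\<close> is the rise that brings the reduced cost of
  \<open>e\<close> to 0, since \<open>e\<close> leads from the unlabelled \<open>u\<close> to the
  labelled \<open>v\<close> while the search runs. The value -1 of \<open>b\<close> records that no
  crossing residual arc has a smaller slack.\<close>

definition scan :: com where
  "scan = ''d'' ::= Sub (N 0) (rcost_exp (V ''e''));; ''b'' ::= N (-1);; For ''a'' ''K'' scan_arc"

definition raise_potentials :: com where
  "raise_potentials = For ''i'' ''n''
    (Cond (Less (Idx ''lab'' (V ''i'')) (N 1))
      (Store ''pi'' (V ''i'') (Add (Idx ''pi'' (V ''i'')) (V ''d''))) SKIP)"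

definition grow :: com where
  "grow = Cond (Less (V ''b'') (N 0)) SKIP
    (''k'' ::= Add (V ''k'') (N 1);; Store ''lab'' (V ''y'') (V ''k'');; Store ''P'' (V ''y'') (V ''b''))"

definition search :: com where
  "search = While (Conj (Less (Idx ''lab'' (V ''u'')) (N 1)) (Less (rcost_exp (V ''e'')) (N 0)))
    (scan;; raise_potentials;; grow)"

text \<open>The residual path runs from \<open>v\<close> to \<open>u\<close>, but \<open>P\<close>
  leads from \<open>u\<close> back to \<open>v\<close>. Testing the head decides the direction of
  use unambiguously, since the ends of a tree arc have different labels.\<close>

definition augment :: com where
  "augment = ''y'' ::= V ''u'';;
    While (Neg (Eq (V ''y'') (V ''v'')))
      (''a'' ::= Idx ''P'' (V ''y'');;
       Cond (Eq (Idx ''H'' (V ''a'')) (V ''y''))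
         (Store ''f'' (V ''a'') (Add (Idx ''f'' (V ''a'')) (N 1));; ''y'' ::= Idx ''T'' (V ''a''))
         (Store ''f'' (V ''a'') (Sub (Idx ''f'' (V ''a'')) (N 1));; ''y'' ::= Idx ''H'' (V ''a'')))"

text \<open>Spare capacity would violate the kilter conditions only if \<open>e\<close> has negative
  reduced cost. In that case the new unit is used at once and returned from head to tail along the
  tree; otherwise it may stay free.\<close>

definition phase :: com where
  "phase =
    ''u'' ::= Idx ''T'' (V ''e'');; ''v'' ::= Idx ''H'' (V ''e'');;
    clear;; Store ''lab'' (V ''v'') (N 1);; ''k'' ::= N 1;;
    search;;
    Cond (Less (rcost_exp (V ''e'')) (N 0))
      (Store ''f'' (V ''e'') (Add (Idx ''f'' (V ''e'')) (N 1));;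
       Store ''cap'' (V ''e'') (Add (Idx ''cap'' (V ''e'')) (N 1));;
       augment)
      (Store ''cap'' (V ''e'') (Add (Idx ''cap'' (V ''e'')) (N 1)))"

definition double :: com where
  "double = For ''e'' ''K''
    (Store ''f'' (V ''e'') (Add (Idx ''f'' (V ''e'')) (Idx ''f'' (V ''e'')));;
     Store ''cap'' (V ''e'') (Add (Idx ''cap'' (V ''e'')) (Idx ''cap'' (V ''e''))))"

text \<open>Dividing by the power of two \<open>q\<close> reads off the leading bits of the target
  capacity \<open>C\<close>, so \<open>cap\<close> runs through the binary prefixes of
  \<open>C\<close>.\<close>

definition level :: com where
  "level = ''q'' ::= Div (V ''q'') (N 2);; double;;
    For ''e'' ''K'' (Cond (Less (Idx ''cap'' (V ''e'')) (Div (Idx ''C'' (V ''e'')) (V ''q''))) phase SKIP)"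

definition scaling :: com where
  "scaling = ''q'' ::= N 1;;
    While (Neg (Less (V ''S'') (V ''q''))) (''q'' ::= Add (V ''q'') (V ''q''));;
    While (Less (N 1) (V ''q'')) level"

lemmas scaling_defs = clear_def scan_arc_def scan_def raise_potentials_def grow_def search_def
  augment_def phase_def double_def level_def scaling_def

lemma written_clear [simp]:
  "written_vars clear = {''i''}" "written_arrs clear = {''lab''}" "silent clear"
  by (simp_all add: clear_def)

lemma written_scan [simp]:
  "written_vars scan = {''r'', ''d'', ''b'', ''y'', ''a''}" "written_arrs scan = {}" "silent scan"
  by (auto simp add: scan_def scan_arc_def)

lemma written_raise_potentials [simp]:
  "written_vars raise_potentials = {''i''}" "written_arrs raise_potentials = {''pi''}"
  "silent raise_potentials"
  by (auto simp add: raise_potentials_def)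

lemma written_grow [simp]:
  "written_vars grow = {''k''}" "written_arrs grow = {''lab'', ''P''}" "silent grow"
  by (auto simp add: grow_def)

lemma written_search [simp]:
  "written_vars search = {''r'', ''d'', ''b'', ''y'', ''a'', ''i'', ''k''}"
  "written_arrs search = {''pi'', ''lab'', ''P''}" "silent search"
  by (auto simp add: search_def)

lemma written_augment [simp]:
  "written_vars augment = {''y'', ''a''}" "written_arrs augment = {''f''}" "silent augment"
  by (auto simp add: augment_def)

lemma written_phase [simp]:
  "written_vars phase = {''u'', ''v'', ''r'', ''d'', ''b'', ''y'', ''a'', ''i'', ''k''}"
  "written_arrs phase = {''pi'', ''lab'', ''P'', ''f'', ''cap''}" "silent phase"
  by (auto simp add: phase_def)

lemma written_double [simp]:
  "written_vars double = {''e''}" "written_arrs double = {''f'', ''cap''}" "silent double"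
  by (auto simp add: double_def)

lemma written_level [simp]:
  "written_vars level = {''u'', ''v'', ''r'', ''d'', ''b'', ''y'', ''a'', ''i'', ''k'', ''e'', ''q''}"
  "written_arrs level = {''pi'', ''lab'', ''P'', ''f'', ''cap''}" "silent level"
  by (auto simp add: level_def)

lemma written_scaling [simp]:
  "written_vars scaling = {''u'', ''v'', ''r'', ''d'', ''b'', ''y'', ''a'', ''i'', ''k'', ''e'', ''q''}"
  "written_arrs scaling = {''pi'', ''lab'', ''P'', ''f'', ''cap''}" "silent scaling"
  by (auto simp add: scaling_def)

lemma mul_free_scaling [simp]: "mul_free scaling"
  by (simp add: scaling_defs rcost_exp_def)

section \<open>Correctness of the scaling program\<close>

context network
begin

definition network_state :: "state \<Rightarrow> bool" where
  "network_state s \<longleftrightarrow> var s ''n'' = n \<and> var s ''K'' = K \<and>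
     arr s ''T'' = T \<and> arr s ''H'' = H \<and> arr s ''W'' = W"

lemma network_state_frame:
  "network_state s \<Longrightarrow> frame c s s' \<Longrightarrow> {''n'', ''K''} \<inter> written_vars c = {} \<Longrightarrow>
    {''T'', ''H'', ''W''} \<inter> written_arrs c = {} \<Longrightarrow> network_state s'"
  by (simp add: network_state_def frame_def)

lemma aval_rcost_exp [simp]:
  "network_state s \<Longrightarrow> aval (rcost_exp a) s = rcost (arr s ''pi'') (aval a s)"
  by (simp add: network_state_def rcost_exp_def rcost_def)

lemma wp_clear:
  assumes "network_state s" "n \<le> int R"
  shows "wp R clear (\<lambda>s'. \<forall>x. 0 \<le> x \<and> x < n \<longrightarrow> arr s' ''lab'' x = 0) s"
  unfolding clear_def
proof (rule wp_For[where n = n and I = "\<lambda>j s'. \<forall>x. 0 \<le> x \<and> x < j \<longrightarrow> arr s' ''lab'' x = 0"])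
  fix j and s' :: state
  assume "\<forall>x. 0 \<le> x \<and> x < j \<longrightarrow> arr s' ''lab'' x = 0" "var s' ''i'' = j"
  then show "wp R (Store ''lab'' (V ''i'') (N 0)) (\<lambda>s''. \<forall>x. 0 \<le> x \<and> x < j + 1 \<longrightarrow>
      arr (s''\<lparr>var := (var s'')(''i'' := j + 1)\<rparr>) ''lab'' x = 0) s'"
    by (intro wp_intros) auto
qed (use assms n_nonneg in \<open>auto simp: network_state_def\<close>)

lemma wp_raise_potentials:
  assumes "network_state s" "n \<le> int R"
  shows "wp R raise_potentials
    (\<lambda>s'. arr s' ''pi'' = shift (arr s ''lab'') (var s ''d'') (arr s ''pi'')) s"
  unfolding raise_potentials_def
proof (rule wp_For[where n = n and I = "\<lambda>j s'. arr s' ''pi'' = (\<lambda>x. if 0 \<le> x \<and> x < j \<and>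
      arr s ''lab'' x < 1 then arr s ''pi'' x + var s ''d'' else arr s ''pi'' x)"], goal_cases)
  case (8 j s')
  have "arr s' ''lab'' = arr s ''lab''" "var s' ''d'' = var s ''d''"
    using 8(1) by (auto simp: frame_def)
  with 8(2-) show ?case by (intro wp_intros) (auto simp: fun_eq_iff)
next
  case (9 s')
  then show ?case by (auto simp: shift_def fun_eq_iff)
qed (use assms n_nonneg in \<open>auto simp: network_state_def\<close>)

lemma slack_bound_Suc:
  assumes "0 \<le> j"
  shows "slack_bound p cap f lab (j + 1) d \<longleftrightarrow> slack_bound p cap f lab j d \<and>
     (0 < lab (T j) \<and> lab (H j) < 1 \<and> f j < cap j \<longrightarrow> d \<le> rcost p j) \<and>
     (0 < lab (H j) \<and> lab (T j) < 1 \<and> 0 < f j \<longrightarrow> d \<le> - rcost p j)"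
  using assms unfolding slack_bound_def zless_add1_eq by blast

lemma slack_bound_mono:
  "slack_bound p cap f lab j d \<Longrightarrow> d' \<le> d \<Longrightarrow> slack_bound p cap f lab j d'"
  unfolding slack_bound_def by (meson order_trans)

text \<open>Updates of \<open>d\<close> are strict, so a recorded arc leaves the reduced cost of
  \<open>e\<close> negative after the shift. The kilter conditions make every candidate slack, and
  hence \<open>d\<close>, nonnegative.\<close>

lemma wp_scan:
  assumes s: "network_state s" and R: "K \<le> int R"
    and e: "0 \<le> - rcost (arr s ''pi'') (var s ''e'')"
    and k: "kilter (arr s ''pi'') (arr s ''cap'') (arr s ''f'')"
  shows "wp R scan (\<lambda>s'. 0 \<le> var s' ''d'' \<and>
     slack_bound (arr s ''pi'') (arr s ''cap'') (arr s ''f'') (arr s ''lab'') K (var s' ''d'') \<and>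
     (var s' ''b'' = -1 \<and> var s' ''d'' = - rcost (arr s ''pi'') (var s ''e'') \<or>
      var s' ''d'' < - rcost (arr s ''pi'') (var s ''e'') \<and>
      leaves (arr s ''pi'') (arr s ''cap'') (arr s ''f'') (arr s ''lab'') (var s' ''d'')
        (var s' ''b'') (var s' ''y''))) s"
    (is "wp R scan ?Q s")
proof -
  let ?p = "arr s ''pi''" and ?cap = "arr s ''cap''" and ?f = "arr s ''f''" and ?lab = "arr s ''lab''"
  let ?I = "\<lambda>j s'. 0 \<le> var s' ''d'' \<and> slack_bound ?p ?cap ?f ?lab j (var s' ''d'') \<and>
     (var s' ''b'' = -1 \<and> var s' ''d'' = - rcost ?p (var s ''e'') \<or>
      var s' ''d'' < - rcost ?p (var s ''e'') \<and>
      leaves ?p ?cap ?f ?lab (var s' ''d'') (var s' ''b'') (var s' ''y''))"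
  define s1 where "s1 = s\<lparr>var := (var s)(''d'' := - rcost ?p (var s ''e''), ''b'' := -1)\<rparr>"
  have "wp R (For ''a'' ''K'' scan_arc) ?Q s1"
  proof (rule wp_For[where n = K and I = ?I])
    fix j s' assume f: "frame (For ''a'' ''K'' scan_arc) s1 s'" and I: "?I j s'"
      and a: "var s' ''a'' = j" "0 \<le> j" "j < K"
    have "arr s' = arr s" using f by (auto simp: frame_def s1_def scan_arc_def)
    moreover have "network_state s'"
      using s f unfolding network_state_def frame_def s1_def scan_arc_def by auto
    moreover have "0 \<le> ?f j" "?f j \<le> ?cap j" "?f j < ?cap j \<Longrightarrow> 0 \<le> rcost ?p j"
      "0 < ?f j \<Longrightarrow> rcost ?p j \<le> 0" using k a by (auto simp: kilter_def)
    moreover have arr: "arr s ''T'' = T" "arr s ''H'' = H" using s by (auto simp: network_state_def)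
    moreover have "rcost ?p j \<le> var s' ''d'' \<Longrightarrow> slack_bound ?p ?cap ?f ?lab j (rcost ?p j)"
      "- rcost ?p j \<le> var s' ''d'' \<Longrightarrow> slack_bound ?p ?cap ?f ?lab j (- rcost ?p j)"
      using I slack_bound_mono by blast+
    ultimately show "wp R scan_arc (\<lambda>s''. ?I (j + 1) (s''\<lparr>var := (var s'')(''a'' := j + 1)\<rparr>)) s'"
      unfolding scan_arc_def using I a
      by (intro wp_intros) (simp_all add: slack_bound_Suc leaves_def, linarith+)
  qed (use assms K_nonneg in \<open>auto simp: network_state_def s1_def scan_arc_def slack_bound_def\<close>)
  then show ?thesis
    unfolding scan_def using s by (intro wp_intros) (simp add: s1_def)
qed

text \<open>The variable \<open>k\<close> counts the labelled nodes. The measure \<open>m\<close>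
  adds one while the reduced cost of \<open>e\<close> is negative, because a round that labels no
  node ends this negativity instead.\<close>

definition search_inv :: "int \<Rightarrow> int \<Rightarrow> nat \<Rightarrow> state \<Rightarrow> bool" where
  "search_inv v e m s \<longleftrightarrow> kilter (arr s ''pi'') (arr s ''cap'') (arr s ''f'') \<and> 0 < arr s ''lab'' v \<and>
     tree (arr s ''pi'') (arr s ''cap'') (arr s ''f'') (arr s ''lab'') (arr s ''P'') v (var s ''k'') \<and>
     (\<forall>x. 0 \<le> x \<and> x < n \<longrightarrow> 0 \<le> arr s ''lab'' x \<and> arr s ''lab'' x \<le> var s ''k'') \<and>
     int (card {x \<in> {0..<n}. arr s ''lab'' x = 0}) + var s ''k'' = n \<and>
     m = card {x \<in> {0..<n}. arr s ''lab'' x = 0} + (if rcost (arr s ''pi'') e < 0 then 1 else 0)"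

lemma wp_search_body:
  assumes s: "network_state s" and R: "K \<le> int R" "n \<le> int R"
    and inv: "search_inv v e m s" and e: "0 \<le> e" "e < K" "T e = u" "H e = v"
    and vars: "var s ''u'' = u" "var s ''v'' = v" "var s ''e'' = e"
    and cond: "arr s ''lab'' u < 1" "rcost (arr s ''pi'') e < 0"
  shows "wp R (scan;; raise_potentials;; grow) (\<lambda>s'. \<exists>m'<m. search_inv v e m' s') s"
proof (rule wp_Seq, rule wp_conseq[OF wp_scan])
  let ?p = "arr s ''pi''" and ?cap = "arr s ''cap''" and ?f = "arr s ''f''" and ?lab = "arr s ''lab''"
    and ?P = "arr s ''P''" and ?k = "var s ''k''"
  fix s1 assume f1: "frame scan s s1" and *: "0 \<le> var s1 ''d'' \<and> slack_bound ?p ?cap ?f ?lab K (var s1 ''d'') \<and>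
     (var s1 ''b'' = -1 \<and> var s1 ''d'' = - rcost ?p (var s ''e'') \<or>
      var s1 ''d'' < - rcost ?p (var s ''e'') \<and>
      leaves ?p ?cap ?f ?lab (var s1 ''d'') (var s1 ''b'') (var s1 ''y''))"
  let ?d = "var s1 ''d''" and ?y = "var s1 ''y''" and ?b = "var s1 ''b''"
  let ?p' = "shift ?lab ?d ?p"
  from inv have i: "kilter ?p ?cap ?f" "0 < ?lab v" "tree ?p ?cap ?f ?lab ?P v ?k"
    "\<And>x. 0 \<le> x \<Longrightarrow> x < n \<Longrightarrow> 0 \<le> ?lab x" "\<And>x. 0 \<le> x \<Longrightarrow> x < n \<Longrightarrow> ?lab x \<le> ?k"
    "int (card {x \<in> {0..<n}. ?lab x = 0}) + ?k = n" "m = card {x \<in> {0..<n}. ?lab x = 0} + 1"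
    using cond by (auto simp: search_inv_def)
  have arr1: "arr s1 = arr s" and k1: "var s1 ''k'' = ?k" using f1 by (auto simp: frame_def)
  have k': "kilter ?p' ?cap ?f" "tree ?p' ?cap ?f ?lab ?P v ?k"
    using kilter_shift tree_shift i * by auto
  \<comment> \<open>The tail \<open>u\<close> of \<open>e\<close> is unlabelled and its head
    \<open>v\<close> labelled, so \<open>e\<close> receives the full shift.\<close>
  have e': "rcost ?p' e = rcost ?p e + ?d"
    using e cond i(2) by (simp add: rcost_shift)
  have v: "0 \<le> v" "v < n" using H_range e by auto
  have "network_state s1" using s f1 by (rule network_state_frame) auto
  then show "wp R (raise_potentials;; grow) (\<lambda>s'. \<exists>m'<m. search_inv v e m' s') s1"
  proof (rule wp_Seq[OF wp_conseq[OF wp_raise_potentials]])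
    fix s2 assume f2: "frame raise_potentials s1 s2"
      and p2: "arr s2 ''pi'' = shift (arr s1 ''lab'') ?d (arr s1 ''pi'')"
    have s2: "arr s2 ''cap'' = ?cap" "arr s2 ''f'' = ?f" "arr s2 ''lab'' = ?lab" "arr s2 ''P'' = ?P"
      "var s2 ''k'' = ?k" "var s2 ''b'' = ?b" "var s2 ''y'' = ?y" "arr s2 ''pi'' = ?p'"
      using f2 k1 p2 by (auto simp: frame_def arr1)
    from * consider "?b = -1" "?d = - rcost ?p e" | "?d < - rcost ?p e" "leaves ?p ?cap ?f ?lab ?d ?b ?y"
      using vars by auto
    then show "wp R grow (\<lambda>s'. \<exists>m'<m. search_inv v e m' s') s2"
    proof cases
      \<comment> \<open>Without a crossing arc of smaller slack, the shift brings the reduced cost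
        of \<open>e\<close> to 0 and the measure loses its additional one.\<close>
      case 1
      then have "search_inv v e (card {x \<in> {0..<n}. ?lab x = 0}) s2"
        using k' i e' by (simp add: search_inv_def s2)
      then show ?thesis unfolding grow_def using 1 i(7)
        by (intro wp_intros) (auto simp: s2)
    next
      case 2
      then have l: "leaves ?p' ?cap ?f ?lab 0 ?b ?y" and b: "0 \<le> ?b" "?b < K"
        using leaves_shift by (auto simp: leaves_def)
      then have y: "0 \<le> ?y" "?y < n" "?lab ?y = 0"
        using T_range[of ?b] H_range[of ?b] i(4)[of ?y] by (auto simp: leaves_def)
      \<comment> \<open>This makes the new label \<open>?k + 1\<close> positive, so that
        \<open>?y\<close> leaves the set of unlabelled nodes.\<close>
      have k0: "0 \<le> ?k" using i(5)[OF v] i(2) by linarith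
      have set: "{x \<in> {0..<n}. (?lab(?y := ?k + 1)) x = 0} = {x \<in> {0..<n}. ?lab x = 0} - {?y}"
        using k0 by auto
      have card: "Suc (card {x \<in> {0..<n}. (?lab(?y := ?k + 1)) x = 0}) = card {x \<in> {0..<n}. ?lab x = 0}"
        unfolding set
        by (rule card_Suc_Diff1) (use y in \<open>auto intro: finite_subset[of _ "{0..<n}"]\<close>)
      let ?s3 = "s2\<lparr>var := (var s2)(''k'' := ?k + 1), arr := (arr s2)(''lab'' := ?lab(?y := ?k + 1),
         ''P'' := ?P(?y := ?b))\<rparr>"
      have "tree ?p' ?cap ?f (?lab(?y := ?k + 1)) (?P(?y := ?b)) v (?k + 1)"
        using tree_grow[OF k'(2) i(2) i(5) l] .
      moreover have "rcost ?p' e < 0" using e' 2 by linarith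
      moreover have "?y \<noteq> v" using y i(2) by auto
      moreover have "0 \<le> (?lab(?y := ?k + 1)) x \<and> (?lab(?y := ?k + 1)) x \<le> ?k + 1"
        if "0 \<le> x" "x < n" for x using that i(4)[of x] i(5)[of x] k0 by auto
      ultimately have "search_inv v e (card {x \<in> {0..<n}. (?lab(?y := ?k + 1)) x = 0} + 1) ?s3"
        using k'(1) i(2,6) card by (simp add: search_inv_def s2 del: fun_upd_apply) (simp add: s2)
      moreover have "card {x \<in> {0..<n}. (?lab(?y := ?k + 1)) x = 0} + 1 < m" using card i(7) by simp
      ultimately have "\<exists>m'<m. search_inv v e m' ?s3" by blast
      then show ?thesis unfolding grow_def using b
        by (intro wp_intros) (simp_all add: s2)
    qed
  qed (rule R)
next
  show "kilter (arr s ''pi'') (arr s ''cap'') (arr s ''f'')" using inv by (simp add: search_inv_def)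
qed (use s R cond vars in auto)

lemma wp_search:
  assumes s: "network_state s" and R: "K \<le> int R" "n < int R"
    and inv: "search_inv v e m s" and e: "0 \<le> e" "e < K" "T e = u" "H e = v"
    and vars: "var s ''u'' = u" "var s ''v'' = v" "var s ''e'' = e"
  shows "wp R search (\<lambda>s'. (\<exists>m'. search_inv v e m' s') \<and>
    (0 < arr s' ''lab'' u \<or> 0 \<le> rcost (arr s' ''pi'') e)) s"
  unfolding search_def
proof (rule wp_While[where I = "search_inv v e" and k = m])
  \<comment> \<open>There are at most \<open>n\<close> unlabelled nodes, and the sign of the reduced
    cost adds one to the measure: this is why \<open>n < R\<close> is assumed strictly.\<close>
  have "card {x \<in> {0..<n}. arr s ''lab'' x = 0} \<le> card {0..<n}" by (rule card_mono) auto
  then show "m \<le> R" using inv R n_nonneg by (auto simp: search_inv_def)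
next
  fix m s' assume f: "frame (scan;; raise_potentials;; grow) s s'" and i: "search_inv v e m s'"
  have ns: "network_state s'" using s f by (rule network_state_frame) auto
  have v: "var s' ''u'' = u" "var s' ''v'' = v" "var s' ''e'' = e" using f vars by (auto simp: frame_def)
  {
    assume "bval (Conj (Less (Idx ''lab'' (V ''u'')) (N 1)) (Less (rcost_exp (V ''e'')) (N 0))) s'"
    with v ns have "arr s' ''lab'' u < 1" "rcost (arr s' ''pi'') e < 0" by auto
    with wp_search_body[OF ns _ _ i e v] R
    show "wp R (scan;; raise_potentials;; grow) (\<lambda>s''. \<exists>m'<m. search_inv v e m' s'') s'" by simp
  }
  {
    assume "\<not> bval (Conj (Less (Idx ''lab'' (V ''u'')) (N 1)) (Less (rcost_exp (V ''e'')) (N 0))) s'"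
    with v ns i show "(\<exists>m'. search_inv v e m' s') \<and>
      (0 < arr s' ''lab'' u \<or> 0 \<le> rcost (arr s' ''pi'') e)" by auto
  }
qed (rule inv)

text \<open>After the unit push over \<open>e\<close>, one unit is in surplus at \<open>v\<close>
  and one is missing at \<open>u\<close>. Each step moves the deficit along a tight tree arc, which
  respects the kilter conditions, to a smaller label, until it meets the surplus at
  \<open>v\<close>. The label of \<open>u\<close> thus bounds the number of steps.\<close>

lemma wp_augment:
  assumes s: "network_state s" and R: "arr s ''lab'' u \<le> int R"
    and k: "kilter (arr s ''pi'') (arr s ''cap'') (arr s ''f'')"
    and t: "tree (arr s ''pi'') (arr s ''cap'') (arr s ''f'') (arr s ''lab'') (arr s ''P'') v (arr s ''lab'' u)"
    and u: "0 \<le> u" "u < n" "0 < arr s ''lab'' u"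
    and ex: "\<And>z. excess (arr s ''f'') z = of_bool (z = v) - of_bool (z = u)"
    and vars: "var s ''u'' = u" "var s ''v'' = v"
  shows "wp R augment (\<lambda>s'. kilter (arr s ''pi'') (arr s ''cap'') (arr s' ''f'') \<and>
     (\<forall>z. excess (arr s' ''f'') z = 0)) s"
  unfolding augment_def
proof (rule wp_Seq, rule wp_Assign)
  let ?p = "arr s ''pi''" and ?cap = "arr s ''cap''" and ?lab = "arr s ''lab''" and ?P = "arr s ''P''"
  let ?I = "\<lambda>m s'. kilter ?p ?cap (arr s' ''f'') \<and> tree ?p ?cap (arr s' ''f'') ?lab ?P v (?lab (var s' ''y'')) \<and>
    0 \<le> var s' ''y'' \<and> var s' ''y'' < n \<and> 0 < ?lab (var s' ''y'') \<and> m = nat (?lab (var s' ''y'')) \<and>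
    (\<forall>z. excess (arr s' ''f'') z = of_bool (z = v) - of_bool (z = var s' ''y''))"
  let ?body = "''a'' ::= Idx ''P'' (V ''y'');;
       Cond (Eq (Idx ''H'' (V ''a'')) (V ''y''))
         (Store ''f'' (V ''a'') (Add (Idx ''f'' (V ''a'')) (N 1));; ''y'' ::= Idx ''T'' (V ''a''))
         (Store ''f'' (V ''a'') (Sub (Idx ''f'' (V ''a'')) (N 1));; ''y'' ::= Idx ''H'' (V ''a''))"
  let ?s = "s\<lparr>var := (var s)(''y'' := aval (V ''u'') s)\<rparr>"
  show "wp R (While (Neg (Eq (V ''y'') (V ''v''))) ?body) (\<lambda>s'. kilter (arr s ''pi'') (arr s ''cap'') (arr s' ''f'') \<and>
     (\<forall>z. excess (arr s' ''f'') z = 0)) ?s"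
  proof (rule wp_While[where I = ?I and k = "nat (?lab u)"])
    show "?I (nat (?lab u)) ?s" using k t u ex vars by simp
    show "nat (?lab u) \<le> R" using R by simp
  next
    fix m s' assume f: "frame ?body ?s s'" and i: "?I m s'" and b: "bval (Neg (Eq (V ''y'') (V ''v''))) s'"
    have a: "arr s' ''P'' = ?P" "arr s' ''H'' = H" "arr s' ''T'' = T" and v: "var s' ''v'' = v"
      using f s vars by (auto simp: frame_def network_state_def)
    let ?y = "var s' ''y''" and ?f = "arr s' ''f''"
    have y: "?y \<noteq> v" using b v by auto
    note step = augment_step[of ?p ?cap ?f ?lab ?P v ?y]
    show "wp R ?body (\<lambda>s''. \<exists>k'<m. ?I k' s'') s'"
    proof (intro wp_intros, goal_cases)
      case 1
      then have "H (?P ?y) = ?y" by (simp add: a)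
      with step[of 1 "T (?P ?y)"] i y show ?case by (simp add: a)
    next
      case 2
      then have "H (?P ?y) \<noteq> ?y" by (auto simp add: a)
      with step[of "-1" "H (?P ?y)"] i y show ?case by (simp add: a)
    qed
  next
    fix m s' assume f: "frame ?body ?s s'" and i: "?I m s'" and b: "\<not> bval (Neg (Eq (V ''y'') (V ''v''))) s'"
    have "var s' ''v'' = v" using f vars by (auto simp: frame_def)
    with b i show "kilter ?p ?cap (arr s' ''f'') \<and> (\<forall>z. excess (arr s' ''f'') z = 0)" by simp
  qed
qed

lemma search_inv_init:
  assumes "kilter (arr s ''pi'') (arr s ''cap'') (arr s ''f'')" "0 \<le> v" "v < n"
    and lab: "\<And>x. 0 \<le> x \<Longrightarrow> x < n \<Longrightarrow> arr s ''lab'' x = of_bool (x = v)" and "var s ''k'' = 1"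
  shows "\<exists>m. search_inv v e m s"
proof -
  have "{x \<in> {0..<n}. arr s ''lab'' x = 0} = {0..<n} - {v}"
    using lab by auto
  then have "int (card {x \<in> {0..<n}. arr s ''lab'' x = 0}) + 1 = n"
    using assms(2,3) by simp
  moreover have "tree (arr s ''pi'') (arr s ''cap'') (arr s ''f'') (arr s ''lab'') (arr s ''P'') v 1"
    using lab by (auto simp: tree_def)
  ultimately show ?thesis using assms unfolding search_inv_def by simp
qed

text \<open>The residual capacity of \<open>e\<close> is unchanged and its negative reduced cost
  permits positive flow. Tree arcs are tight, hence different from \<open>e\<close>, so the tree
  survives.\<close>

lemma saturate:
  assumes k: "kilter p cap f" and t: "tree p cap f lab P v k" and u: "lab u \<le> k"
    and ex: "\<And>z. excess f z = 0" and e: "0 \<le> e" "e < K" "rcost p e < 0"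
  shows "kilter p (cap(e := cap e + 1)) (f(e := f e + 1))"
    "tree p (cap(e := cap e + 1)) (f(e := f e + 1)) lab P v (lab u)"
    "excess (f(e := f e + 1)) z = of_bool (z = H e) - of_bool (z = T e)"
proof -
  show "kilter p (cap(e := cap e + 1)) (f(e := f e + 1))"
    using k e by (auto simp: kilter_def)
  show "excess (f(e := f e + 1)) z = of_bool (z = H e) - of_bool (z = T e)"
    using e ex by (auto simp: excess_upd)
  show "tree p (cap(e := cap e + 1)) (f(e := f e + 1)) lab P v (lab u)"
    unfolding tree_def
  proof (intro allI impI)
    fix z assume z: "0 \<le> z \<and> z < n \<and> 0 < lab z \<and> lab z \<le> lab u \<and> z \<noteq> v"
    then have *: "0 \<le> P z \<and> P z < K \<and> rcost p (P z) = 0 \<and>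
     (H (P z) = z \<and> f (P z) < cap (P z) \<and> 0 < lab (T (P z)) \<and> lab (T (P z)) < lab z \<or>
      T (P z) = z \<and> 0 < f (P z) \<and> 0 < lab (H (P z)) \<and> lab (H (P z)) < lab z)"
      using t u unfolding tree_def by auto
    then have "P z \<noteq> e" using e by auto
    then show "0 \<le> P z \<and> P z < K \<and> rcost p (P z) = 0 \<and>
     (H (P z) = z \<and> (f(e := f e + 1)) (P z) < (cap(e := cap e + 1)) (P z) \<and> 0 < lab (T (P z)) \<and> lab (T (P z)) < lab z \<or>
      T (P z) = z \<and> 0 < (f(e := f e + 1)) (P z) \<and> 0 < lab (H (P z)) \<and> lab (H (P z)) < lab z)"
      using * by simp
  qed
qed

lemma wp_phase:
  assumes s: "network_state s" and R: "K \<le> int R" "n < int R"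
    and k: "kilter (arr s ''pi'') (arr s ''cap'') (arr s ''f'')" and ex: "\<And>z. excess (arr s ''f'') z = 0"
    and e: "var s ''e'' = e" "0 \<le> e" "e < K"
  shows "wp R phase (\<lambda>s'. kilter (arr s' ''pi'') (arr s' ''cap'') (arr s' ''f'') \<and>
     (\<forall>z. excess (arr s' ''f'') z = 0) \<and> arr s' ''cap'' = (arr s ''cap'')(e := arr s ''cap'' e + 1)) s"
    (is "wp R phase ?Q s")
  unfolding phase_def
proof (rule wp_Seq[OF wp_Assign], rule wp_Seq[OF wp_Assign])
  let ?cap = "arr s ''cap''" and ?f = "arr s ''f''"
  let ?u = "T e" and ?v = "H e"
  let ?s0 = "s\<lparr>var := (var s)(''u'' := ?u, ''v'' := ?v)\<rparr>"
  have uv: "0 \<le> ?u" "?u < n" "0 \<le> ?v" "?v < n" using T_range H_range e by auto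
  let ?rest = "search;;
    Cond (Less (rcost_exp (V ''e'')) (N 0))
      (Store ''f'' (V ''e'') (Add (Idx ''f'' (V ''e'')) (N 1));;
       Store ''cap'' (V ''e'') (Add (Idx ''cap'' (V ''e'')) (N 1));;
       augment)
      (Store ''cap'' (V ''e'') (Add (Idx ''cap'' (V ''e'')) (N 1)))"
  have ns0: "network_state ?s0" using s by (simp add: network_state_def)
  have "wp R (clear;; Store ''lab'' (V ''v'') (N 1);; ''k'' ::= N 1;; ?rest) ?Q ?s0"
  proof (rule wp_Seq[OF wp_conseq[OF wp_clear[OF ns0]]])
    fix s1 assume f1: "frame clear ?s0 s1" and lab: "\<forall>x. 0 \<le> x \<and> x < n \<longrightarrow> arr s1 ''lab'' x = 0"
    define s2 where "s2 = s1\<lparr>arr := (arr s1)(''lab'' := (arr s1 ''lab'')(?v := 1)), var := (var s1)(''k'' := 1)\<rparr>"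
    have ns2: "network_state s2" and v2: "var s2 ''u'' = ?u" "var s2 ''v'' = ?v" "var s2 ''e'' = e"
      "arr s2 ''f'' = ?f" "arr s2 ''cap'' = ?cap" "arr s2 ''pi'' = arr s ''pi''"
      using s f1 e by (auto simp: network_state_def s2_def frame_def)
    have "\<exists>m. search_inv ?v e m s2"
      using k uv lab by (intro search_inv_init) (simp_all add: v2, auto simp: s2_def)
    then obtain m where i2: "search_inv ?v e m s2" by blast
    have "wp R ?rest ?Q s2"
    proof (rule wp_Seq[OF wp_conseq[OF wp_search[OF ns2 R i2 e(2,3) refl refl v2(1,2,3)]]])
      fix s3 assume f3: "frame search s2 s3" and "(\<exists>m'. search_inv ?v e m' s3) \<and>
        (0 < arr s3 ''lab'' ?u \<or> 0 \<le> rcost (arr s3 ''pi'') e)"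
      then obtain m' where i3: "search_inv ?v e m' s3"
        and c3: "0 < arr s3 ''lab'' ?u \<or> 0 \<le> rcost (arr s3 ''pi'') e" by blast
      have ns3: "network_state s3" using ns2 f3 by (rule network_state_frame) auto
      have v3: "var s3 ''u'' = ?u" "var s3 ''v'' = ?v" "var s3 ''e'' = e"
        "arr s3 ''f'' = ?f" "arr s3 ''cap'' = ?cap"
        using f3 v2 by (auto simp: frame_def)
      let ?p = "arr s3 ''pi''" and ?lab = "arr s3 ''lab''" and ?P = "arr s3 ''P''"
      have k3: "kilter ?p ?cap ?f" and t3: "tree ?p ?cap ?f ?lab ?P ?v (var s3 ''k'')"
        and l3: "?lab ?u \<le> var s3 ''k''" "var s3 ''k'' \<le> n"
        using i3 uv unfolding search_inv_def v3 by auto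
      let ?f' = "?f(e := ?f e + 1)" and ?cap' = "?cap(e := ?cap e + 1)"
      show "wp R (Cond (Less (rcost_exp (V ''e'')) (N 0))
        (Store ''f'' (V ''e'') (Add (Idx ''f'' (V ''e'')) (N 1));;
         Store ''cap'' (V ''e'') (Add (Idx ''cap'' (V ''e'')) (N 1));;
         augment)
        (Store ''cap'' (V ''e'') (Add (Idx ''cap'' (V ''e'')) (N 1)))) ?Q s3"
      proof (intro wp_Cond wp_Seq[OF wp_Store] wp_Store)
        assume "\<not> bval (Less (rcost_exp (V ''e'')) (N 0)) s3"
        then have "0 \<le> rcost ?p e" using ns3 v3 by simp
        \<comment> \<open>Spare capacity on \<open>e\<close> is admissible now that its reduced cost
          is nonnegative.\<close>
        then have "kilter ?p ?cap' ?f" using k3 by (auto simp: kilter_def)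
        with ex show "?Q (s3\<lparr>arr := (arr s3)(''cap'' := (arr s3 ''cap'')(aval (V ''e'') s3 :=
            aval (Add (Idx ''cap'' (V ''e'')) (N 1)) s3))\<rparr>)"
          by (simp add: v3)
      next
        assume "bval (Less (rcost_exp (V ''e'')) (N 0)) s3"
        then have rc: "rcost ?p e < 0" using ns3 v3 by simp
        note sat = saturate[OF k3 t3 l3(1) ex e(2,3) rc]
        let ?s4 = "s3\<lparr>arr := (arr s3)(''f'' := ?f', ''cap'' := ?cap')\<rparr>"
        have "wp R augment (\<lambda>s'. kilter (arr ?s4 ''pi'') (arr ?s4 ''cap'') (arr s' ''f'') \<and>
           (\<forall>z. excess (arr s' ''f'') z = 0)) ?s4"
          by (rule wp_augment[where u = ?u and v = ?v]) (use ns3 sat v3 c3 rc uv l3 R in \<open>auto simp: network_state_def\<close>)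
        then have "wp R augment ?Q ?s4"
          by (rule wp_conseq) (simp add: frame_def)
        then show "wp R augment ?Q (s3\<lparr>arr := (arr s3)(''f'' := (arr s3 ''f'')(aval (V ''e'') s3 := aval (Add (Idx ''f'' (V ''e'')) (N 1)) s3))\<rparr>
            \<lparr>arr := (arr (s3\<lparr>arr := (arr s3)(''f'' := (arr s3 ''f'')(aval (V ''e'') s3 := aval (Add (Idx ''f'' (V ''e'')) (N 1)) s3))\<rparr>))
              (''cap'' := (arr (s3\<lparr>arr := (arr s3)(''f'' := (arr s3 ''f'')(aval (V ''e'') s3 := aval (Add (Idx ''f'' (V ''e'')) (N 1)) s3))\<rparr>) ''cap'')
                (aval (V ''e'') (s3\<lparr>arr := (arr s3)(''f'' := (arr s3 ''f'')(aval (V ''e'') s3 := aval (Add (Idx ''f'' (V ''e'')) (N 1)) s3))\<rparr>) :=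
                 aval (Add (Idx ''cap'' (V ''e'')) (N 1)) (s3\<lparr>arr := (arr s3)(''f'' := (arr s3 ''f'')(aval (V ''e'') s3 := aval (Add (Idx ''f'' (V ''e'')) (N 1)) s3))\<rparr>)))\<rparr>)"
          by (simp add: v3)
      qed
    qed
    then show "wp R (Store ''lab'' (V ''v'') (N 1);; ''k'' ::= N 1;; ?rest) ?Q s1"
      using v2 by (intro wp_Seq[OF wp_Store] wp_Seq[OF wp_Assign]) (simp add: s2_def)
  qed (use R in auto)
  then show "wp R (clear;; Store ''lab'' (V ''v'') (N 1);; ''k'' ::= N 1;; ?rest) ?Q
      (s\<lparr>var := (var s)(''u'' := aval (Idx ''T'' (V ''e'')) s)\<rparr>
       \<lparr>var := (var (s\<lparr>var := (var s)(''u'' := aval (Idx ''T'' (V ''e'')) s)\<rparr>))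
         (''v'' := aval (Idx ''H'' (V ''e'')) (s\<lparr>var := (var s)(''u'' := aval (Idx ''T'' (V ''e'')) s)\<rparr>))\<rparr>)"
    using s e by (simp add: network_state_def)
qed

lemma kilter_double:
  "kilter p cap f \<Longrightarrow> kilter p (\<lambda>a. 2 * cap a) (\<lambda>a. 2 * f a)"
  unfolding kilter_def by simp

lemma kilter_cong:
  "(\<And>a. 0 \<le> a \<Longrightarrow> a < K \<Longrightarrow> cap a = cap' a \<and> f a = f' a) \<Longrightarrow> kilter p cap f = kilter p cap' f'"
  unfolding kilter_def by auto

lemma wp_double:
  assumes "network_state s" "K \<le> int R"
  shows "wp R double (\<lambda>s'. \<forall>a. 0 \<le> a \<and> a < K \<longrightarrow>
     arr s' ''f'' a = 2 * arr s ''f'' a \<and> arr s' ''cap'' a = 2 * arr s ''cap'' a) s"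
  unfolding double_def
proof (rule wp_For[where n = K and I = "\<lambda>j s'.
    arr s' ''f'' = (\<lambda>a. if 0 \<le> a \<and> a < j then 2 * arr s ''f'' a else arr s ''f'' a) \<and>
    arr s' ''cap'' = (\<lambda>a. if 0 \<le> a \<and> a < j then 2 * arr s ''cap'' a else arr s ''cap'' a)"], goal_cases)
  case (8 j s')
  then show ?case by (intro wp_intros) (auto simp: fun_eq_iff)
qed (use assms K_nonneg in \<open>auto simp: network_state_def\<close>)

lemma wp_level:
  assumes s: "network_state s" and R: "K \<le> int R" "n < int R"
    and k: "kilter (arr s ''pi'') (arr s ''cap'') (arr s ''f'')" and ex: "\<And>z. excess (arr s ''f'') z = 0"
    and q: "var s ''q'' = 2 * q" "0 < q"
    and cap: "\<And>a. 0 \<le> a \<Longrightarrow> a < K \<Longrightarrow> arr s ''cap'' a = arr s ''C'' a div (2 * q)"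
  shows "wp R level (\<lambda>s'. kilter (arr s' ''pi'') (arr s' ''cap'') (arr s' ''f'') \<and>
     (\<forall>z. excess (arr s' ''f'') z = 0) \<and> var s' ''q'' = q \<and>
     (\<forall>a. 0 \<le> a \<and> a < K \<longrightarrow> arr s' ''cap'' a = arr s ''C'' a div q)) s"
    (is "wp R level ?Q s")
  unfolding level_def
proof (rule wp_Seq[OF wp_Assign])
  let ?s0 = "s\<lparr>var := (var s)(''q'' := aval (Div (V ''q'') (N 2)) s)\<rparr>"
  have ns0: "network_state ?s0" using s by (simp add: network_state_def)
  let ?C = "arr s ''C''"
  let ?body = "Cond (Less (Idx ''cap'' (V ''e'')) (Div (Idx ''C'' (V ''e'')) (V ''q''))) phase SKIP"
  show "wp R (double;; For ''e'' ''K'' ?body) ?Q ?s0"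
  proof (rule wp_Seq[OF wp_conseq[OF wp_double[OF ns0 R(1)]]])
    fix s1 assume f1: "frame double ?s0 s1" and "\<forall>a. 0 \<le> a \<and> a < K \<longrightarrow>
      arr s1 ''f'' a = 2 * arr ?s0 ''f'' a \<and> arr s1 ''cap'' a = 2 * arr ?s0 ''cap'' a"
    then have d: "arr s1 ''f'' a = 2 * arr s ''f'' a" "arr s1 ''cap'' a = 2 * arr s ''cap'' a"
      if "0 \<le> a" "a < K" for a using that by auto
    have ns1: "network_state s1" using ns0 f1 by (rule network_state_frame) auto
    have v1: "var s1 ''q'' = q" "arr s1 ''C'' = ?C" "arr s1 ''pi'' = arr s ''pi''"
      using f1 q by (auto simp: frame_def)
    let ?I = "\<lambda>j s'. kilter (arr s' ''pi'') (arr s' ''cap'') (arr s' ''f'') \<and>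
      (\<forall>z. excess (arr s' ''f'') z = 0) \<and>
      (\<forall>a. 0 \<le> a \<and> a < K \<longrightarrow> arr s' ''cap'' a = (if a < j then ?C a div q else 2 * (?C a div (2 * q))))"
    show "wp R (For ''e'' ''K'' ?body) ?Q s1"
    proof (rule wp_For[where n = K and I = ?I])
      have "kilter (arr s1 ''pi'') (arr s1 ''cap'') (arr s1 ''f'')"
        using kilter_double[OF k] d unfolding v1 by (subst kilter_cong) auto
      moreover have "excess (arr s1 ''f'') z = 0" for z
        using ex[of z] excess_double[of "arr s ''f''" z]
          excess_cong[of "arr s1 ''f''" "\<lambda>a. 2 * arr s ''f'' a" z] d by simp
      ultimately show "?I 0 (s1\<lparr>var := (var s1)(''e'' := 0)\<rparr>)" using d cap by simp
    next
      fix j s' assume f: "frame (For ''e'' ''K'' ?body) s1 s'" and i: "?I j s'"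
        and j: "var s' ''e'' = j" "0 \<le> j" "j < K"
      have ns': "network_state s'" using ns1 f by (rule network_state_frame) auto
      have v': "var s' ''q'' = q" "arr s' ''C'' = ?C" using f v1 by (auto simp: frame_def)
      have dbl: "?C j div q = 2 * (?C j div (2 * q)) \<or> ?C j div q = 2 * (?C j div (2 * q)) + 1"
        using div_double_cases q by blast
      show "wp R ?body (\<lambda>s''. ?I (j + 1) (s''\<lparr>var := (var s'')(''e'' := j + 1)\<rparr>)) s'"
      proof (rule wp_Cond)
        assume "bval (Less (Idx ''cap'' (V ''e'')) (Div (Idx ''C'' (V ''e'')) (V ''q''))) s'"
        then have "?C j div q = 2 * (?C j div (2 * q)) + 1" using dbl i j by (simp add: v')
        then have eq: "(\<forall>a. 0 \<le> a \<and> a < K \<longrightarrow> ((arr s' ''cap'')(j := arr s' ''cap'' j + 1)) a =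
          (if a < j + 1 then ?C a div q else 2 * (?C a div (2 * q))))" using i j by auto
        show "wp R phase (\<lambda>s''. ?I (j + 1) (s''\<lparr>var := (var s'')(''e'' := j + 1)\<rparr>)) s'"
          by (rule wp_conseq[OF wp_phase[OF ns' R _ _ j]]) (use i eq in auto)
      next
        assume "\<not> bval (Less (Idx ''cap'' (V ''e'')) (Div (Idx ''C'' (V ''e'')) (V ''q''))) s'"
        then have "?C j div q = 2 * (?C j div (2 * q))" using dbl i j by (simp add: v')
        then have eq: "(\<forall>a. 0 \<le> a \<and> a < K \<longrightarrow> arr s' ''cap'' a =
          (if a < j + 1 then ?C a div q else 2 * (?C a div (2 * q))))" using i j by auto
        then show "wp R SKIP (\<lambda>s''. ?I (j + 1) (s''\<lparr>var := (var s'')(''e'' := j + 1)\<rparr>)) s'"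
          using i by (intro wp_Skip) simp
      qed
    next
      fix s' assume f: "frame (For ''e'' ''K'' ?body) s1 s'" and i: "?I K s'"
      have "var s' ''q'' = q" using f v1 by (auto simp: frame_def)
      with i show "?Q s'" by auto
    qed (use ns1 R K_nonneg in \<open>auto simp: network_state_def\<close>)
  qed
qed

lemma wp_scaling:
  assumes s: "network_state s" and R: "K \<le> int R" "n < int R" "B < R"
    and zero: "arr s ''pi'' = (\<lambda>_. 0)" "arr s ''cap'' = (\<lambda>_. 0)" "arr s ''f'' = (\<lambda>_. 0)"
    and S: "0 \<le> var s ''S''" "var s ''S'' < 2 ^ B"
    and C: "\<And>a. 0 \<le> a \<Longrightarrow> a < K \<Longrightarrow> 0 \<le> arr s ''C'' a \<and> arr s ''C'' a \<le> var s ''S''"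
  shows "wp R scaling (\<lambda>s'. (\<exists>p. kilter p (arr s ''C'') (arr s' ''f'')) \<and>
     (\<forall>z. excess (arr s' ''f'') z = 0)) s"
    (is "wp R scaling ?Q s")
  unfolding scaling_def
proof (rule wp_Seq[OF wp_Assign])
  let ?C = "arr s ''C''" and ?S = "var s ''S''"
  let ?s0 = "s\<lparr>var := (var s)(''q'' := aval (N 1) s)\<rparr>"
  show "wp R (While (Neg (Less (V ''S'') (V ''q''))) (''q'' ::= Add (V ''q'') (V ''q''));;
    While (Less (N 1) (V ''q'')) level) ?Q ?s0"
  proof (rule wp_Seq, rule wp_While[where I = "\<lambda>k s'. \<exists>j. var s' ''q'' = 2 ^ j \<and> j + k = B" and k = B])
    fix k s' assume f: "frame (''q'' ::= Add (V ''q'') (V ''q'')) ?s0 s'"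
      and i: "\<exists>j. var s' ''q'' = 2 ^ j \<and> j + k = B" and b: "bval (Neg (Less (V ''S'') (V ''q''))) s'"
    have S': "var s' ''S'' = ?S" using f by (simp add: frame_def)
    obtain j where j: "var s' ''q'' = 2 ^ j" "j + k = B" using i by blast
    \<comment> \<open>At \<open>k = 0\<close> the value \<open>q = 2 ^ B\<close> would already
      exceed \<open>S\<close>, against the loop test.\<close>
    have "k \<noteq> 0"
    proof
      assume "k = 0"
      then show False using S b S' j by auto
    qed
    then show "wp R (''q'' ::= Add (V ''q'') (V ''q''))
      (\<lambda>s''. \<exists>k'<k. \<exists>j. var s'' ''q'' = 2 ^ j \<and> j + k' = B) s'"
      using j by (intro wp_Assign exI[of _ "k - 1"] conjI exI[of _ "Suc j"]) auto
  next
    fix k s' assume f: "frame (''q'' ::= Add (V ''q'') (V ''q'')) ?s0 s'"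
      and i: "\<exists>j. var s' ''q'' = 2 ^ j \<and> j + k = B" and b: "\<not> bval (Neg (Less (V ''S'') (V ''q''))) s'"
    obtain j where j: "var s' ''q'' = 2 ^ j" "j \<le> B" using i by auto
    have v: "arr s' = arr s" "var s' ''S'' = ?S" and ns: "network_state s'"
      using f s by (auto simp: frame_def network_state_def)
    let ?J = "\<lambda>k s'. kilter (arr s' ''pi'') (arr s' ''cap'') (arr s' ''f'') \<and>
      (\<forall>z. excess (arr s' ''f'') z = 0) \<and> var s' ''q'' = 2 ^ k \<and>
      (\<forall>a. 0 \<le> a \<and> a < K \<longrightarrow> arr s' ''cap'' a = ?C a div 2 ^ k)"
    show "wp R (While (Less (N 1) (V ''q'')) level) ?Q s'"
    proof (rule wp_While[where I = ?J and k = j])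
      \<comment> \<open>The first scale exceeds \<open>S\<close> and hence all capacities, which
        therefore round to 0; the zero flow with zero potentials is then in kilter.\<close>
      have "?C a div 2 ^ j = 0" if "0 \<le> a" "a < K" for a
        using C[OF that] b v j by (intro div_pos_pos_trivial) auto
      then show "?J j s'" using j v zero by (simp add: kilter_def excess_def)
    next
      fix k s'' assume f2: "frame level s' s''" and i: "?J k s''" and b: "bval (Less (N 1) (V ''q'')) s''"
      have ns2: "network_state s''" using ns f2 by (rule network_state_frame) auto
      have C2: "arr s'' ''C'' = ?C" using f2 v by (auto simp: frame_def)
      obtain k' where k': "k = Suc k'" using b i by (cases k) auto
      have "wp R level (?J k') s''"
        by (rule wp_conseq[OF wp_level[OF ns2 R(1,2), of "2 ^ k'"]]) (use i C2 k' in auto)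
      then show "wp R level (\<lambda>s''. \<exists>k'<k. ?J k' s'') s''"
        by (rule wp_conseq) (use k' in blast)
    next
      fix k s'' assume i: "?J k s''" and "\<not> bval (Less (N 1) (V ''q'')) s''"
      then have "\<not> (1::int) < 2 ^ k" by simp
      then have "k = 0" by (metis neq0_conv one_less_numeral_iff one_less_power semiring_norm(76))
      then have "kilter (arr s'' ''pi'') ?C (arr s'' ''f'')"
        using i by (subst kilter_cong[of _ "arr s'' ''cap''" _ "arr s'' ''f''"]) auto
      with i show "?Q s''" by blast
    qed (use j R in auto)
  qed (use R in auto)
qed

end

section \<open>The reactive problem as a circulation problem\<close>

text \<open>For an arc with nominal flow \<open>x\<close>, lower bound \<open>l\<close> and capacity \<open>u\<close>, the correction of the
  nominal flow consists of three arcs, stored in the blocks starting at \<open>0\<close>, \<open>m\<close> and \<open>2 * m\<close>: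
  an optional increase beyond \<open>max x l\<close> of cost \<open>1\<close>, the enforced increase from \<open>x\<close> to
  \<open>max x l\<close>, whose cost \<open>-1 - S\<close> is so small that it is used whenever possible, and a decrease,
  directed from head to tail, of cost \<open>1\<close>.\<close>

definition build_arc :: com where
  "build_arc =
    ''t'' ::= Idx ''in'' (Add (V ''a'') (N 2));; ''h'' ::= Idx ''in'' (Add (V ''a'') (V ''oh''));;
    ''z'' ::= Idx ''in'' (Add (V ''a'') (V ''ox''));;
    Cond (Less (V ''z'') (Idx ''in'' (Add (V ''a'') (V ''ol''))))
      (''z'' ::= Idx ''in'' (Add (V ''a'') (V ''ol''))) SKIP;;
    Store ''T'' (V ''a'') (V ''t'');;
    Store ''T'' (Add (V ''a'') (V ''m'')) (V ''t'');;
    Store ''T'' (Add (V ''a'') (V ''mm'')) (V ''h'');;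
    Store ''H'' (V ''a'') (V ''h'');;
    Store ''H'' (Add (V ''a'') (V ''m'')) (V ''h'');;
    Store ''H'' (Add (V ''a'') (V ''mm'')) (V ''t'');;
    Store ''W'' (V ''a'') (N 1);;
    Store ''W'' (Add (V ''a'') (V ''mm'')) (N 1);;
    Store ''C'' (V ''a'') (N 0);;
    Cond (Less (V ''z'') (Idx ''in'' (Add (V ''a'') (V ''ou''))))
      (Store ''C'' (V ''a'') (Sub (Idx ''in'' (Add (V ''a'') (V ''ou''))) (V ''z''))) SKIP;;
    Store ''C'' (Add (V ''a'') (V ''m'')) (Sub (V ''z'') (Idx ''in'' (Add (V ''a'') (V ''ox''))));;
    Store ''C'' (Add (V ''a'') (V ''mm'')) (Sub (V ''z'') (Idx ''in'' (Add (V ''a'') (V ''ol''))));;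
    ''S'' ::= Add (V ''S'') (Add (Idx ''C'' (V ''a''))
      (Add (Idx ''C'' (Add (V ''a'') (V ''m''))) (Idx ''C'' (Add (V ''a'') (V ''mm'')))))"

text \<open>Each offset is the start of a block of \<open>encode_instance\<close>. The sum
  \<open>K + K\<close> skips the six blocks of length \<open>m\<close> that precede the node
  demands, so \<open>ol\<close> reads the arc demands of the scenario and not the nominal
  ones.\<close>

definition offsets :: com where
  "offsets =
    ''n'' ::= Idx ''in'' (N 0);; ''m'' ::= Idx ''in'' (N 1);;
    ''mm'' ::= Add (V ''m'') (V ''m'');; ''K'' ::= Add (V ''mm'') (V ''m'');;
    ''oh'' ::= Add (V ''m'') (N 2);; ''ou'' ::= Add (V ''mm'') (N 2);;
    ''ol'' ::= Add (Add (V ''K'') (V ''K'')) (Add (V ''n'') (N 2));;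
    ''ox'' ::= Add (V ''ol'') (V ''m'')"

text \<open>The cost of an enforced arc involves the total capacity \<open>S\<close>, which is known
  only after all arcs have been built; hence the second pass.\<close>

definition build :: com where
  "build = For ''a'' ''m'' build_arc;;
    For ''a'' ''m'' (Store ''W'' (Add (V ''a'') (V ''m'')) (Sub (N (-1)) (V ''S'')))"

definition answer_arc :: com where
  "answer_arc =
    ''z'' ::= Sub (Add (Idx ''in'' (Add (V ''a'') (V ''ox'')))
                       (Add (Idx ''f'' (V ''a'')) (Idx ''f'' (Add (V ''a'') (V ''m'')))))
                  (Idx ''f'' (Add (V ''a'') (V ''mm'')));;
    Store ''X'' (V ''a'') (V ''z'');;
    Cond (Conj (Neg (Less (V ''z'') (Idx ''in'' (Add (V ''a'') (V ''ol'')))))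
               (Neg (Less (Idx ''in'' (Add (V ''a'') (V ''ou''))) (V ''z''))))
      SKIP (''ok'' ::= N 0)"

definition answer :: com where
  "answer = ''ok'' ::= N 1;; For ''a'' ''m'' answer_arc;;
    Cond (Less (N 0) (V ''ok''))
      (Write (N 1);; For ''a'' ''m'' (Write (Idx ''X'' (V ''a''))))
      (Write (N 0))"

definition mcf_program :: com where
  "mcf_program = offsets;; build;; scaling;; answer"

lemma mul_free_mcf_program: "mul_free mcf_program"
  by (simp add: mcf_program_def offsets_def build_def build_arc_def answer_def answer_arc_def)

section \<open>Specifications of network construction and output\<close>

lemma written_build:
  "written_vars build = {''a'', ''t'', ''h'', ''z'', ''S''}"
  "written_arrs build = {''T'', ''H'', ''W'', ''C''}" "silent build"
  by (auto simp: build_def build_arc_def)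

definition arc_inputs :: "int \<Rightarrow> (int \<Rightarrow> int) \<Rightarrow> (int \<Rightarrow> int) \<Rightarrow> (int \<Rightarrow> int) \<Rightarrow> (int \<Rightarrow> int) \<Rightarrow>
    (int \<Rightarrow> int) \<Rightarrow> state \<Rightarrow> bool" where
  "arc_inputs m t h u l x s \<longleftrightarrow> var s ''m'' = m \<and> var s ''mm'' = 2 * m \<and>
    (\<forall>a. 0 \<le> a \<and> a < m \<longrightarrow> arr s ''in'' (a + 2) = t a \<and> arr s ''in'' (a + var s ''oh'') = h a \<and>
      arr s ''in'' (a + var s ''ou'') = u a \<and> arr s ''in'' (a + var s ''ol'') = l a \<and>
      arr s ''in'' (a + var s ''ox'') = x a)"

lemma arc_inputs_frame:
  "arc_inputs m t h u l x s \<Longrightarrow> frame c s s' \<Longrightarrow>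
    {''m'', ''mm'', ''oh'', ''ou'', ''ol'', ''ox''} \<inter> written_vars c = {} \<Longrightarrow>
    ''in'' \<notin> written_arrs c \<Longrightarrow> arc_inputs m t h u l x s'"
  by (simp add: arc_inputs_def frame_def)

locale correction =
  fixes m :: int and t h u l x :: "int \<Rightarrow> int"
begin

text \<open>The outer maximum concerns arcs whose scenario demand exceeds the capacity: the
  constructed capacities must stay nonnegative, and infeasibility then shows in the final test of
  the bounds.\<close>

definition cap0 where "cap0 a = max 0 (u a - max (x a) (l a))"
definition cap1 where "cap1 a = max (x a) (l a) - x a"
definition cap2 where "cap2 a = max (x a) (l a) - l a"

definition total_cap where "total_cap j = (\<Sum>a\<in>{0..<j}. cap0 a + (cap1 a + cap2 a))"

definition blocks_except_cost where
  "blocks_except_cost T H W C j \<longleftrightarrow> (\<forall>a. 0 \<le> a \<and> a < j \<longrightarrow>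
     T a = t a \<and> T (a + m) = t a \<and> T (a + 2 * m) = h a \<and>
     H a = h a \<and> H (a + m) = h a \<and> H (a + 2 * m) = t a \<and>
     W a = 1 \<and> W (a + 2 * m) = (1::int) \<and>
     C a = cap0 a \<and> C (a + m) = cap1 a \<and> C (a + 2 * m) = cap2 a)"

definition blocks where
  "blocks T H W C \<longleftrightarrow> blocks_except_cost T H W C m \<and>
     (\<forall>a. 0 \<le> a \<and> a < m \<longrightarrow> W (a + m) = - 1 - total_cap m)"

lemma total_cap_Suc: "0 \<le> j \<Longrightarrow> total_cap (j + 1) = total_cap j + (cap0 j + (cap1 j + cap2 j))"
proof -
  assume "0 \<le> j"
  then have "{0..<j + 1} = insert j {0..<j}" by auto
  then show ?thesis by (simp add: total_cap_def)
qed

lemma wp_build: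
  assumes s: "arc_inputs m t h u l x s" and m: "0 \<le> m" "m \<le> int R" and S: "var s ''S'' = 0"
  shows "wp R build (\<lambda>s'. blocks (arr s' ''T'') (arr s' ''H'') (arr s' ''W'') (arr s' ''C'') \<and>
     var s' ''S'' = total_cap m) s"
  unfolding build_def
proof (rule wp_Seq, rule wp_For[where n = m and I = "\<lambda>j s'. blocks_except_cost (arr s' ''T'')
      (arr s' ''H'') (arr s' ''W'') (arr s' ''C'') j \<and> var s' ''S'' = total_cap j"], goal_cases)
  case (8 j s')
  have i: "arc_inputs m t h u l x s'"
    using s 8(1) by (rule arc_inputs_frame) (auto simp: build_arc_def)
  have j: "0 \<le> j" "j < m" "var s' ''a'' = j" by fact+
  from i j have v: "var s' ''m'' = m" "var s' ''mm'' = 2 * m" "arr s' ''in'' (j + 2) = t j"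
    "arr s' ''in'' (j + var s' ''oh'') = h j" "arr s' ''in'' (j + var s' ''ou'') = u j"
    "arr s' ''in'' (j + var s' ''ol'') = l j" "arr s' ''in'' (j + var s' ''ox'') = x j"
    by (auto simp: arc_inputs_def)
  have step: "blocks_except_cost (T(j := t j, j + m := t j, j + 2 * m := h j))
      (H(j := h j, j + m := h j, j + 2 * m := t j)) (W(j := 1, j + 2 * m := 1))
      (C(j := cap0 j, j + m := cap1 j, j + 2 * m := cap2 j)) (j + 1)"
    if "blocks_except_cost T H W C j" for T H W C
    unfolding blocks_except_cost_def
  proof (intro allI impI)
    fix a assume "0 \<le> a \<and> a < j + 1"
    then consider "a = j" | "0 \<le> a" "a < j" by linarith
    then show "(T(j := t j, j + m := t j, j + 2 * m := h j)) a = t a \<and>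
     (T(j := t j, j + m := t j, j + 2 * m := h j)) (a + m) = t a \<and>
     (T(j := t j, j + m := t j, j + 2 * m := h j)) (a + 2 * m) = h a \<and>
     (H(j := h j, j + m := h j, j + 2 * m := t j)) a = h a \<and>
     (H(j := h j, j + m := h j, j + 2 * m := t j)) (a + m) = h a \<and>
     (H(j := h j, j + m := h j, j + 2 * m := t j)) (a + 2 * m) = t a \<and>
     (W(j := 1, j + 2 * m := 1)) a = 1 \<and> (W(j := 1, j + 2 * m := 1)) (a + 2 * m) = (1::int) \<and>
     (C(j := cap0 j, j + m := cap1 j, j + 2 * m := cap2 j)) a = cap0 a \<and>
     (C(j := cap0 j, j + m := cap1 j, j + 2 * m := cap2 j)) (a + m) = cap1 a \<and>
     (C(j := cap0 j, j + m := cap1 j, j + 2 * m := cap2 j)) (a + 2 * m) = cap2 a"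
    proof cases
      case 1
      then show ?thesis using j by simp
    next
      case 2
      then show ?thesis using j that by (simp add: blocks_except_cost_def)
    qed
  qed
  note step' = step[of "arr s' ''T''" "arr s' ''H''" "arr s' ''W''" "arr s' ''C''"]
  have "max (x j) (l j) = (if x j < l j then l j else x j)" by simp
  then have c: "cap0 j = (if (if x j < l j then l j else x j) < u j then
        u j - (if x j < l j then l j else x j) else 0)"
    "cap1 j = (if x j < l j then l j else x j) - x j" "cap2 j = (if x j < l j then l j else x j) - l j"
    by (auto simp: cap0_def cap1_def cap2_def)
  show ?case
    unfolding build_arc_def
    by (insert 8(2) j step', (rule wp_Seq | rule wp_Assign wp_Store wp_Skip, simp add: v
      | rule wp_Cond | simp add: v c total_cap_Suc)+)
next
  case (9 s')
  have i: "arc_inputs m t h u l x s'"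
    using s 9(1) by (rule arc_inputs_frame) (auto simp: build_arc_def)
  show ?case
  proof (rule wp_For[where n = m and I = "\<lambda>j s''. arr s'' ''T'' = arr s' ''T'' \<and> arr s'' ''H'' = arr s' ''H'' \<and>
      arr s'' ''C'' = arr s' ''C'' \<and> var s'' ''S'' = total_cap m \<and>
      arr s'' ''W'' = (\<lambda>a. if m \<le> a \<and> a < m + j then - 1 - total_cap m else arr s' ''W'' a)"], goal_cases)
    case (8 j s'')
    have "arc_inputs m t h u l x s''"
      using i 8(1) by (rule arc_inputs_frame) auto
    then have "var s'' ''m'' = m" by (simp add: arc_inputs_def)
    with 8(2-) show ?case
      by (intro wp_intros) (auto simp: fun_eq_iff)
  next
    case (9 s'')
    with \<open>blocks_except_cost _ _ _ _ m \<and> _\<close> show ?case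
      by (auto simp: blocks_def blocks_except_cost_def)
  qed (use i m 9 in \<open>auto simp: arc_inputs_def\<close>)
qed (use s m S in \<open>auto simp: arc_inputs_def blocks_except_cost_def total_cap_def build_arc_def\<close>)

definition corrected where
  "corrected f a = x a + (f a + f (a + m)) - f (a + 2 * m)"

lemma wp_answer:
  assumes s: "arc_inputs m t h u l x s" and m: "0 \<le> m" "m \<le> int R" and out: "out_tape s = []"
  shows "wp R answer (\<lambda>s'. out_tape s' =
    (if \<forall>a. 0 \<le> a \<and> a < m \<longrightarrow> l a \<le> corrected (arr s ''f'') a \<and> corrected (arr s ''f'') a \<le> u a
     then 1 # map (\<lambda>i. corrected (arr s ''f'') (int i)) [0..<nat m] else [0])) s"
  unfolding answer_def
proof (rule wp_Seq, rule wp_Assign, rule wp_Seq)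
  let ?y = "corrected (arr s ''f'')"
  let ?s0 = "s\<lparr>var := (var s)(''ok'' := aval (N 1) s)\<rparr>"
  let ?I = "\<lambda>j s'. (\<forall>a. 0 \<le> a \<and> a < j \<longrightarrow> arr s' ''X'' a = ?y a) \<and>
    (0 < var s' ''ok'' \<longleftrightarrow> (\<forall>a. 0 \<le> a \<and> a < j \<longrightarrow> l a \<le> ?y a \<and> ?y a \<le> u a))"
  have i0: "arc_inputs m t h u l x ?s0" using s by (simp add: arc_inputs_def)
  show "wp R (For ''a'' ''m'' answer_arc) (wp R (Cond (Less (N 0) (V ''ok''))
      (Write (N 1);; For ''a'' ''m'' (Write (Idx ''X'' (V ''a''))))
      (Write (N 0))) (\<lambda>s'. out_tape s' =
    (if \<forall>a. 0 \<le> a \<and> a < m \<longrightarrow> l a \<le> ?y a \<and> ?y a \<le> u a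
     then 1 # map (\<lambda>i. ?y (int i)) [0..<nat m] else [0]))) ?s0"
  proof (rule wp_For[where n = m and I = ?I], goal_cases)
    case (8 j s')
    have i: "arc_inputs m t h u l x s'" "arr s' ''f'' = arr s ''f''"
      using i0 8(1) by (rule arc_inputs_frame) (use 8(1) in \<open>auto simp: answer_arc_def frame_def\<close>)
    have j: "0 \<le> j" "j < m" "var s' ''a'' = j" by fact+
    from i j have v: "var s' ''m'' = m" "var s' ''mm'' = 2 * m"
      "arr s' ''in'' (j + var s' ''ou'') = u j"
      "arr s' ''in'' (j + var s' ''ol'') = l j" "arr s' ''in'' (j + var s' ''ox'') = x j"
      by (auto simp: arc_inputs_def)
    have y: "x j + (arr s ''f'' j + arr s ''f'' (j + m)) - arr s ''f'' (j + 2 * m) = ?y j"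
      by (simp add: corrected_def)
    have Suc: "(\<forall>a. 0 \<le> a \<and> a < j + 1 \<longrightarrow> Q a) \<longleftrightarrow> (\<forall>a. 0 \<le> a \<and> a < j \<longrightarrow> Q a) \<and> Q j" for Q
      using j unfolding zless_add1_eq by blast
    show ?case unfolding answer_arc_def Suc using 8(2) j
      by (intro wp_intros) (simp_all add: v i y, auto)
  next
    case (9 s')
    have v: "var s' ''m'' = m" and o: "out_tape s' = []"
      using 9(1) s out by (auto simp: frame_def arc_inputs_def answer_arc_def)
    show ?case
    proof (rule wp_Cond, rule wp_Seq, rule wp_Write)
      assume "bval (Less (N 0) (V ''ok'')) s'"
      with 9(2) have ok: "\<forall>a. 0 \<le> a \<and> a < m \<longrightarrow> l a \<le> ?y a \<and> ?y a \<le> u a" by simp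
      let ?s1 = "s'\<lparr>out_tape := out_tape s' @ [aval (N 1) s']\<rparr>"
      show "wp R (For ''a'' ''m'' (Write (Idx ''X'' (V ''a'')))) (\<lambda>s'. out_tape s' =
        (if \<forall>a. 0 \<le> a \<and> a < m \<longrightarrow> l a \<le> ?y a \<and> ?y a \<le> u a
         then 1 # map (\<lambda>i. ?y (int i)) [0..<nat m] else [0])) ?s1"
      proof (rule wp_For[where n = m and
            I = "\<lambda>j s''. out_tape s'' = 1 # map (\<lambda>i. ?y (int i)) [0..<nat j]"], goal_cases)
        case (8 j s'')
        have "arr s'' ''X'' j = ?y j" using 8 9(2) by (simp add: frame_def)
        moreover have "nat (j + 1) = Suc (nat j)" using 8 by simp
        ultimately show ?case using 8 by (intro wp_Write) simp
      next
        case (9 s'')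
        then show ?case using ok by simp
      qed (use v o m in auto)
    next
      assume "\<not> bval (Less (N 0) (V ''ok'')) s'"
      with 9(2) have "\<not> (\<forall>a. 0 \<le> a \<and> a < m \<longrightarrow> l a \<le> ?y a \<and> ?y a \<le> u a)" by simp
      then show "wp R (Write (N 0)) (\<lambda>s'. out_tape s' =
        (if \<forall>a. 0 \<le> a \<and> a < m \<longrightarrow> l a \<le> ?y a \<and> ?y a \<le> u a
         then 1 # map (\<lambda>i. ?y (int i)) [0..<nat m] else [0])) s'"
        using o by (intro wp_Write) simp
    qed
  qed (use i0 m in \<open>auto simp: arc_inputs_def answer_arc_def\<close>)
qed

end

section \<open>Circulations as corrections of the nominal flow\<close>

lemma sum_blocks:
  fixes g :: "int \<Rightarrow> int"
  assumes "0 \<le> m"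
  shows "(\<Sum>b\<in>{0..<3 * m}. g b) = (\<Sum>a\<in>{0..<m}. g a + (g (a + m) + g (a + 2 * m)))"
proof -
  have "{0..<3 * m} = {0..<m} \<union> ({m..<2 * m} \<union> {2 * m..<3 * m})" using assms by auto
  moreover have "sum g ({0..<m} \<union> ({m..<2 * m} \<union> {2 * m..<3 * m})) =
      sum g {0..<m} + (sum g {m..<2 * m} + sum g {2 * m..<3 * m})"
    by (subst sum.union_disjoint; auto)+
  moreover have "sum g {m..<2 * m} = (\<Sum>a\<in>{0..<m}. g (a + m))"
    by (rule sum.reindex_bij_witness[of _ "\<lambda>a. a + m" "\<lambda>a. a - m"]) auto
  moreover have "sum g {2 * m..<3 * m} = (\<Sum>a\<in>{0..<m}. g (a + 2 * m))"
    by (rule sum.reindex_bij_witness[of _ "\<lambda>a. a + 2 * m" "\<lambda>a. a - 2 * m"]) auto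
  ultimately show ?thesis by (simp add: sum.distrib)
qed

locale correction_network = correction m t h u l x + network n "3 * m" T H W
  for m :: int and t h u l x and n T H W +
  fixes C :: "int \<Rightarrow> int"
  assumes blocks: "blocks T H W C"
begin

lemma m_nonneg: "0 \<le> m"
  using K_nonneg by simp

text \<open>Inflow minus outflow in the given digraph, hence the negative of a node demand.\<close>

definition imbalance :: "(int \<Rightarrow> int) \<Rightarrow> int \<Rightarrow> int" where
  "imbalance z v = (\<Sum>a\<in>{0..<m}. z a * (of_bool (h a = v) - of_bool (t a = v)))"

lemma block_values:
  assumes "0 \<le> a" "a < m"
  shows "T a = t a" "T (a + m) = t a" "T (a + 2 * m) = h a"
    "H a = h a" "H (a + m) = h a" "H (a + 2 * m) = t a"
    "W a = 1" "W (a + m) = - 1 - total_cap m" "W (a + 2 * m) = 1"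
    "C a = cap0 a" "C (a + m) = cap1 a" "C (a + 2 * m) = cap2 a"
  using blocks assms by (auto simp: blocks_def blocks_except_cost_def)

text \<open>A decrease is stored as a reversed arc, so it counts with the same minus sign as in
  \<open>corrected\<close>. Circulations of the constructed network are thus changes of
  \<open>x\<close> that keep every node balance.\<close>

lemma excess_eq_imbalance: "excess f v = imbalance (\<lambda>a. corrected f a - x a) v"
  unfolding excess_def imbalance_def sum_blocks[OF m_nonneg]
proof (rule sum.cong)
  fix a assume "a \<in> {0..<m}"
  then have "0 \<le> a" "a < m" by auto
  note bv = block_values[OF this]
  show "f a * (of_bool (H a = v) - of_bool (T a = v)) +
      (f (a + m) * (of_bool (H (a + m) = v) - of_bool (T (a + m) = v)) +
       f (a + 2 * m) * (of_bool (H (a + 2 * m) = v) - of_bool (T (a + 2 * m) = v))) =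
      (corrected f a - x a) * (of_bool (h a = v) - of_bool (t a = v))"
    unfolding bv corrected_def by (simp only: algebra_simps)
qed simp

lemma imbalance_diff: "imbalance (\<lambda>a. y a - z a) v = imbalance y v - imbalance z v"
  unfolding imbalance_def sum_subtractf[symmetric] by (rule sum.cong) (auto simp: algebra_simps)

lemma imbalance_corrected:
  "excess f v = 0 \<Longrightarrow> imbalance (corrected f) v = imbalance x v"
  by (simp add: excess_eq_imbalance imbalance_diff)

lemma cost_eq:
  "(\<Sum>b\<in>{0..<3 * m}. W b * f b) =
    (\<Sum>a\<in>{0..<m}. f a + f (a + 2 * m)) - (1 + total_cap m) * (\<Sum>a\<in>{0..<m}. f (a + m))"
  unfolding sum_blocks[OF m_nonneg] sum_distrib_left sum_subtractf[symmetric]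
  by (rule sum.cong) (simp_all add: block_values, simp add: algebra_simps)

text \<open>The converse construction, turning a scenario flow \<open>g\<close> into a circulation
  with all enforced arcs full. What remains of \<open>g - x\<close> goes to the optional increase or
  to the decrease, never to both, so the three parts add up to the absolute change.\<close>

definition split_change :: "(int \<Rightarrow> int) \<Rightarrow> int \<Rightarrow> int" where
  "split_change g b =
    (if b < m then max 0 (g b - x b - cap1 b)
     else if b < 2 * m then cap1 (b - m) else max 0 (x (b - 2 * m) - g (b - 2 * m)))"

text \<open>The existence of a feasible \<open>g\<close> forces the optimal circulation
  \<open>f\<close> to fill the enforced arcs. With this part of the cost fixed, comparing the
  remaining costs bounds the distance to \<open>x\<close>.\<close>

lemma optimal_correction:
  assumes k: "kilter p C f" and ex: "\<And>v. excess f v = 0"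
    and g: "\<And>a. 0 \<le> a \<Longrightarrow> a < m \<Longrightarrow> l a \<le> g a \<and> g a \<le> u a"
    and x: "\<And>a. 0 \<le> a \<Longrightarrow> a < m \<Longrightarrow> x a \<le> u a"
    and bal: "\<And>v. imbalance g v = imbalance x v"
  shows "0 \<le> a \<Longrightarrow> a < m \<Longrightarrow> l a \<le> corrected f a \<and> corrected f a \<le> u a"
    and "(\<Sum>a\<in>{0..<m}. \<bar>corrected f a - x a\<bar>) \<le> (\<Sum>a\<in>{0..<m}. \<bar>g a - x a\<bar>)"
proof -
  let ?g = "split_change g" and ?S = "total_cap m"
  have split: "0 \<le> ?g a" "?g a \<le> cap0 a" "?g (a + m) = cap1 a" "0 \<le> cap1 a"
    "0 \<le> ?g (a + 2 * m)" "?g (a + 2 * m) \<le> cap2 a" "?g a + ?g (a + m) - ?g (a + 2 * m) = g a - x a"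
    "?g a + ?g (a + m) + ?g (a + 2 * m) = \<bar>g a - x a\<bar>" if "0 \<le> a" "a < m" for a
    using g[OF that] x[OF that] that by (auto simp: split_change_def cap0_def cap1_def cap2_def)
  have f: "0 \<le> f a" "f a \<le> cap0 a" "0 \<le> f (a + m)" "f (a + m) \<le> cap1 a" "0 \<le> f (a + 2 * m)"
    "f (a + 2 * m) \<le> cap2 a" if "0 \<le> a" "a < m" for a
    using k that block_values[OF that] unfolding kilter_def
    by (smt (verit))+
  have "imbalance (\<lambda>a. corrected ?g a - x a) v = imbalance (\<lambda>a. g a - x a) v" for v
    unfolding imbalance_def
  proof (rule sum.cong)
    fix a assume "a \<in> {0..<m}"
    then have "corrected ?g a - x a = g a - x a"
      using split(7)[of a] by (simp add: corrected_def)
    then show "(corrected ?g a - x a) * (of_bool (h a = v) - of_bool (t a = v)) =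
        (g a - x a) * (of_bool (h a = v) - of_bool (t a = v))" by simp
  qed simp
  then have ex': "excess ?g v = 0" for v
    using bal by (simp add: excess_eq_imbalance imbalance_diff)
  have "0 \<le> ?g b \<and> ?g b \<le> C b" if b: "0 \<le> b" "b < 3 * m" for b
  proof -
    consider "b < m" | "m \<le> b" "b < 2 * m" | "2 * m \<le> b" by linarith
    then show ?thesis
    proof cases
      case 1
      then show ?thesis using split[of b] block_values[of b] b by simp
    next
      case 2
      then show ?thesis using split[of "b - m"] block_values[of "b - m"] b by simp
    next
      case 3
      then show ?thesis using split[of "b - 2 * m"] block_values[of "b - 2 * m"] b by simp
    qed
  qed
  from kilter_optimal[OF k ex ex' this]
  have opt: "(\<Sum>a\<in>{0..<m}. f a + f (a + 2 * m)) - (1 + ?S) * (\<Sum>a\<in>{0..<m}. f (a + m)) \<le>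
     (\<Sum>a\<in>{0..<m}. ?g a + ?g (a + 2 * m)) - (1 + ?S) * (\<Sum>a\<in>{0..<m}. ?g (a + m))"
    by (simp add: cost_eq)
  have gm: "(\<Sum>a\<in>{0..<m}. ?g (a + m)) = (\<Sum>a\<in>{0..<m}. cap1 a)"
    using split(3) by (intro sum.cong) auto
  have f0: "0 \<le> (\<Sum>a\<in>{0..<m}. f a + f (a + 2 * m))"
    using f by (intro sum_nonneg) auto
  have g0: "(\<Sum>a\<in>{0..<m}. ?g a + ?g (a + 2 * m)) \<le> ?S"
    unfolding total_cap_def
  proof (rule sum_mono)
    fix a assume "a \<in> {0..<m}"
    then show "?g a + ?g (a + 2 * m) \<le> cap0 a + (cap1 a + cap2 a)"
      using split(2,4,6)[of a] by simp
  qed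
  have S0: "0 \<le> ?S" using f0 g0 split by (smt (verit) atLeastLessThan_iff sum_nonneg)
  have fm: "(\<Sum>a\<in>{0..<m}. f (a + m)) = (\<Sum>a\<in>{0..<m}. cap1 a)"
  proof (rule ccontr)
    assume ne: "(\<Sum>a\<in>{0..<m}. f (a + m)) \<noteq> (\<Sum>a\<in>{0..<m}. cap1 a)"
    have "(\<Sum>a\<in>{0..<m}. f (a + m)) \<le> (\<Sum>a\<in>{0..<m}. cap1 a)"
      using f by (intro sum_mono) auto
    with ne have "(\<Sum>a\<in>{0..<m}. f (a + m)) + 1 \<le> (\<Sum>a\<in>{0..<m}. cap1 a)" by linarith
    \<comment> \<open>With \<open>E\<close> the sum of all \<open>cap1\<close>, missing an enforced
      unit means a cost of at least \<open>- (1 + ?S) * (E - 1)\<close>, while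
      \<open>split_change g\<close> costs at most \<open>?S - (1 + ?S) * E\<close>, which is smaller
      by 1.\<close>
    then have "(1 + ?S) * ((\<Sum>a\<in>{0..<m}. f (a + m)) + 1) \<le> (1 + ?S) * (\<Sum>a\<in>{0..<m}. cap1 a)"
      using S0 by (intro mult_left_mono) auto
    then show False using opt f0 g0 unfolding gm by (simp add: algebra_simps)
  qed
  have "(\<Sum>a\<in>{0..<m}. cap1 a - f (a + m)) = 0" using fm by (simp add: sum_subtractf)
  then have f1: "f (a + m) = cap1 a" if "0 \<le> a" "a < m" for a
    using f that by (subst (asm) sum_nonneg_eq_0_iff) auto
  show "l a \<le> corrected f a \<and> corrected f a \<le> u a" if "0 \<le> a" "a < m"
    using f[OF that] f1[OF that] g[OF that] x[OF that]
    by (auto simp: corrected_def cap0_def cap1_def cap2_def)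
  \<comment> \<open>Only an inequality, because \<open>f\<close> might increase and decrease the
    same arc; for \<open>split_change g\<close> the corresponding relation below is an
    equality.\<close>
  have "(\<Sum>a\<in>{0..<m}. \<bar>corrected f a - x a\<bar>) \<le> (\<Sum>a\<in>{0..<m}. f a + f (a + 2 * m) + cap1 a)"
  proof (rule sum_mono)
    fix a assume "a \<in> {0..<m}"
    then show "\<bar>corrected f a - x a\<bar> \<le> f a + f (a + 2 * m) + cap1 a"
      using f[of a] f1[of a] by (simp add: corrected_def)
  qed
  also have "\<dots> \<le> (\<Sum>a\<in>{0..<m}. ?g a + ?g (a + 2 * m) + cap1 a)"
    using opt unfolding fm gm by (simp add: sum.distrib)
  also have "\<dots> = (\<Sum>a\<in>{0..<m}. \<bar>g a - x a\<bar>)"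
  proof (rule sum.cong)
    fix a assume "a \<in> {0..<m}"
    then show "?g a + ?g (a + 2 * m) + cap1 a = \<bar>g a - x a\<bar>"
      using split(3,8)[of a] by simp
  qed simp
  finally show "(\<Sum>a\<in>{0..<m}. \<bar>corrected f a - x a\<bar>) \<le> (\<Sum>a\<in>{0..<m}. \<bar>g a - x a\<bar>)" .
qed

end

text \<open>Each arc contributes at most \<open>3 * 2 ^ B\<close>, and \<open>3 * m\<close> is below
  \<open>2 ^ (3 * k)\<close>. This crude exponent is enough: it keeps the number of scaling levels
  linear in the number of arcs and the bit length.\<close>

lemma (in correction) total_cap_bound:
  assumes m: "0 \<le> m" "m \<le> int k"
    and b: "\<And>a. 0 \<le> a \<Longrightarrow> a < m \<Longrightarrow> 0 \<le> x a \<and> x a < 2 ^ B \<and> 0 \<le> l a \<and> l a < 2 ^ B \<and> 0 \<le> u a \<and> u a < 2 ^ B"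
  shows "0 \<le> total_cap m" "total_cap m < 2 ^ (3 * k + B)"
    "0 \<le> a \<Longrightarrow> a < m \<Longrightarrow> cap0 a \<in> {0..total_cap m} \<and> cap1 a \<in> {0..total_cap m} \<and> cap2 a \<in> {0..total_cap m}"
proof -
  have c: "0 \<le> cap0 a" "0 \<le> cap1 a" "0 \<le> cap2 a" "cap0 a + (cap1 a + cap2 a) \<le> 3 * 2 ^ B"
    if "0 \<le> a" "a < m" for a
    using b[OF that] by (auto simp: cap0_def cap1_def cap2_def)
  show "0 \<le> total_cap m" unfolding total_cap_def
    using c by (intro sum_nonneg) auto
  have "total_cap m \<le> (\<Sum>a\<in>{0..<m}. 3 * 2 ^ B)" unfolding total_cap_def
    using c by (intro sum_mono) auto
  also have "\<dots> = 3 * m * 2 ^ B" using m by simp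
  also have "\<dots> < 2 ^ (3 * k) * 2 ^ B"
  proof (rule mult_strict_right_mono)
    have "3 * m \<le> int (3 * k)" using m by simp
    also have "\<dots> < int (2 ^ (3 * k))" by (simp only: of_nat_less_iff less_exp)
    finally show "3 * m < 2 ^ (3 * k)" by simp
  qed simp
  finally show "total_cap m < 2 ^ (3 * k + B)" by (simp add: power_add)
  assume a: "0 \<le> a" "a < m"
  have "cap0 a + (cap1 a + cap2 a) \<le> total_cap m" unfolding total_cap_def
    using c a by (intro member_le_sum) auto
  with c[OF a] show "cap0 a \<in> {0..total_cap m} \<and> cap1 a \<in> {0..total_cap m} \<and> cap2 a \<in> {0..total_cap m}"
    by auto
qed

lemma less_three_blocks:
  fixes b :: int
  assumes "0 \<le> b" "b < 3 * m"
  obtains a where "0 \<le> a" "a < m" "b = a \<or> b = a + m \<or> b = a + 2 * m"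
proof -
  consider "b < m" | "m \<le> b" "b < 2 * m" | "2 * m \<le> b" by linarith
  then show ?thesis
  proof cases
    case 1 then show ?thesis using assms that[of b] by simp
  next
    case 2 then show ?thesis using assms that[of "b - m"] by simp
  next
    case 3 then show ?thesis using assms that[of "b - 2 * m"] by simp
  qed
qed

section \<open>Input layout and the reactive problem\<close>

lemma encode_instance_nth:
  fixes I defines "n \<equiv> card (verts (net I))" and "m \<equiv> card (arcs (net I))"
  shows "length (encode_instance I) = 2 + 8 * m + n"
    and "encode_instance I ! 0 = int n" "encode_instance I ! 1 = int m"
    and "i < m \<Longrightarrow> encode_instance I ! (i + 2) = int (tail (net I) i)"
    and "i < m \<Longrightarrow> encode_instance I ! (i + (m + 2)) = int (head (net I) i)"
    and "i < m \<Longrightarrow> encode_instance I ! (i + (2 * m + 2)) = int (capacity I i)"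
    and "i < m \<Longrightarrow> encode_instance I ! (i + (6 * m + n + 2)) = int (scenario I i)"
    and "i < m \<Longrightarrow> encode_instance I ! (i + (7 * m + n + 2)) = x_nom I i"
  by (simp_all add: encode_instance_def Let_def nth_append n_def[symmetric] m_def[symmetric] nth_Cons')

lemma flow_balance_eq:
  fixes G :: "('v, nat) pre_digraph" and z :: "nat \<Rightarrow> int"
  assumes "arcs G = {..<m}"
  shows "(\<Sum>a\<in>out_arcs G v. z a) - (\<Sum>a\<in>in_arcs G v. z a) =
    - (\<Sum>a\<in>{0..<int m}. z (nat a) * (of_bool (head G (nat a) = v) - of_bool (tail G (nat a) = v)))"
proof -
  have "(\<Sum>a\<in>out_arcs G v. z a) = (\<Sum>a<m. z a * of_bool (tail G a = v))"
    unfolding out_arcs_def assms by (rule sum.mono_neutral_cong_left) auto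
  moreover have "(\<Sum>a\<in>in_arcs G v. z a) = (\<Sum>a<m. z a * of_bool (head G a = v))"
    unfolding in_arcs_def assms by (rule sum.mono_neutral_cong_left) auto
  moreover have "(\<Sum>a\<in>{0..<int m}. z (nat a) * (of_bool (head G (nat a) = v) - of_bool (tail G (nat a) = v))) =
      (\<Sum>a<m. z a * (of_bool (head G a = v) - of_bool (tail G a = v)))"
    by (rule sum.reindex_bij_witness[of _ int nat]) auto
  ultimately show ?thesis
    by (simp add: right_diff_distrib sum_subtractf)
qed

lemma sum_arcs_int: "(\<Sum>a<m. F a) = (\<Sum>a\<in>{0..<int m}. F (nat a))"
  by (rule sum.reindex_bij_witness[of _ nat int]) auto

text \<open>The test of the bounds decides feasibility: if it succeeds, the corrected flow is itself
  a scenario flow, and if any scenario flow exists, \<open>optimal_correction\<close> makes the test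
  succeed.\<close>

lemma minimization_answer_corrected:
  fixes I
  defines "G \<equiv> net I" and "m \<equiv> card (arcs (net I))" and "k \<equiv> card (verts (net I))"
  defines "t \<equiv> \<lambda>a. int (tail G (nat a))" and "h \<equiv> \<lambda>a. int (head G (nat a))"
    and "u \<equiv> \<lambda>a. int (capacity I (nat a))" and "l \<equiv> \<lambda>a. int (scenario I (nat a))"
    and "x \<equiv> \<lambda>a. x_nom I (nat a)"
  assumes I: "I \<in> MCF_reactive_instances"
    and net: "correction_network (int m) t h u l x n T H W C"
    and kilter: "network.kilter (3 * int m) T H W p C f"
    and ex: "\<And>v. network.excess (3 * int m) T H f v = 0"
  shows "minimization_answer scenario_flows (\<lambda>I x. d_val (net I) x (x_nom I)) encode_flow I
    (if \<forall>a. 0 \<le> a \<and> a < int m \<longrightarrow> l a \<le> correction.corrected (int m) x f a \<and>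
       correction.corrected (int m) x f a \<le> u a
     then 1 # map (\<lambda>i. correction.corrected (int m) x f (int i)) [0..<nat (int m)] else [0])"
    (is "minimization_answer ?X ?obj _ _ (if ?ok then ?sol else _)")
proof -
  interpret correction_network "int m" t h u l x n T H W C by (rule net)
  have arcs: "arcs G = {..<m}" and verts: "verts G = {..<k}" and "fin_digraph G"
    and nom: "x_nom I \<in> feasible_flows G (arc_demand I) (capacity I) (node_demand I)"
    using I unfolding MCF_reactive_instances_def G_def m_def k_def by blast+
  then have wf: "wf_digraph G" by (simp add: fin_digraph_def)
  \<comment> \<open>Flows are extensional, hence the value \<open>undefined\<close> off the
    arcs.\<close>
  define y where "y a = (if a < m then corrected f (int a) else undefined)" for a
  have imb: "(\<Sum>a\<in>out_arcs G v. z a) - (\<Sum>a\<in>in_arcs G v. z a) = - imbalance (\<lambda>a. z (nat a)) (int v)" for z v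
    unfolding flow_balance_eq[OF arcs] imbalance_def unfolding h_def t_def by simp
  have y_imb: "imbalance (\<lambda>a. y (nat a)) v = imbalance x v" for v
  proof -
    have "imbalance (\<lambda>a. y (nat a)) v = imbalance (corrected f) v"
      unfolding imbalance_def by (rule sum.cong) (auto simp: y_def)
    then show ?thesis using imbalance_corrected ex by simp
  qed
  have bal_nom: "- imbalance x (int v) = node_demand I v" if "v \<in> verts G" for v
    using nom that unfolding feasible_flows_def x_def imb[symmetric] by blast
  have feasible: "y \<in> ?X I" if ?ok
  proof -
    have "int (scenario I a) \<le> y a \<and> y a \<le> int (capacity I a)" if "a \<in> arcs G" for a
      using \<open>?ok\<close>[rule_format, of "int a"] that by (simp add: arcs y_def u_def l_def)
    moreover have "(\<Sum>a\<in>out_arcs G v. y a) - (\<Sum>a\<in>in_arcs G v. y a) = node_demand I v"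
      if "v \<in> verts G" for v
      using bal_nom[OF that] unfolding imb y_imb .
    moreover have "y \<in> extensional (arcs G)" by (simp add: extensional_def y_def arcs)
    ultimately show ?thesis unfolding scenario_flows_def feasible_flows_def G_def[symmetric] by blast
  qed
  have optimal: "?ok \<and> ?obj I y \<le> ?obj I g" if g: "g \<in> ?X I" for g
  proof -
    have "imbalance (\<lambda>a. g (nat a)) v = imbalance x v" for v
    proof (cases "0 \<le> v \<and> v < int k")
      case True
      then have "nat v \<in> verts G" by (simp add: verts nat_less_iff)
      then have "- imbalance (\<lambda>a. g (nat a)) (int (nat v)) = node_demand I (nat v)"
        using g unfolding scenario_flows_def feasible_flows_def G_def[symmetric] imb[symmetric] by blast
      then show ?thesis using bal_nom[OF \<open>nat v \<in> verts G\<close>] True by simp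
    next
      \<comment> \<open>\<open>optimal_correction\<close> asks for equal imbalance at every integer.
        An integer that is no node is touched by no arc, so both sums are 0.\<close>
      case False
      have "h a \<noteq> v" "t a \<noteq> v" if "a \<in> {0..<int m}" for a
      proof -
        have "nat a \<in> arcs G" using that by (auto simp: arcs nat_less_iff)
        then have "head G (nat a) \<in> verts G" "tail G (nat a) \<in> verts G"
          using wf_digraph.head_in_verts[OF wf] wf_digraph.tail_in_verts[OF wf] by blast+
        then have "head G (nat a) < k" "tail G (nat a) < k" unfolding verts by simp_all
        then show "h a \<noteq> v" "t a \<noteq> v" using False unfolding h_def t_def by linarith+
      qed
      then show ?thesis unfolding imbalance_def by (intro sum.cong) simp_all
    qed
    moreover have "l a \<le> g (nat a) \<and> g (nat a) \<le> u a" if "0 \<le> a" "a < int m" for a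
    proof -
      have "nat a \<in> arcs G" using that by (auto simp: arcs nat_less_iff)
      then show ?thesis using g
        unfolding scenario_flows_def feasible_flows_def G_def[symmetric] l_def u_def by blast
    qed
    moreover have "x a \<le> u a" if "0 \<le> a" "a < int m" for a
    proof -
      have "nat a \<in> arcs G" using that by (auto simp: arcs nat_less_iff)
      then show ?thesis using nom unfolding feasible_flows_def x_def u_def by blast
    qed
    ultimately have opt: "?ok" "(\<Sum>a\<in>{0..<int m}. \<bar>corrected f a - x a\<bar>) \<le>
        (\<Sum>a\<in>{0..<int m}. \<bar>g (nat a) - x a\<bar>)"
      using optimal_correction[OF kilter ex, of "\<lambda>a. g (nat a)"] by blast+
    have "?obj I y = (\<Sum>a\<in>{0..<int m}. \<bar>corrected f a - x a\<bar>)"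
      unfolding d_val_def G_def[symmetric] arcs sum_arcs_int by (rule sum.cong) (auto simp: y_def x_def)
    moreover have "?obj I g = (\<Sum>a\<in>{0..<int m}. \<bar>g (nat a) - x a\<bar>)"
      unfolding d_val_def G_def[symmetric] arcs sum_arcs_int x_def ..
    ultimately show ?thesis using opt by simp
  qed
  have sol: "?sol = 1 # encode_flow I y"
    by (simp add: encode_flow_def y_def m_def[symmetric])
  show ?thesis
  proof (cases "?X I = {}")
    case True
    then show ?thesis using feasible unfolding minimization_answer_def by auto
  next
    case False
    then have ok: ?ok using optimal by blast
    have "is_arg_min (?obj I) (\<lambda>x. x \<in> ?X I) y"
      unfolding is_arg_min_def using optimal feasible[OF ok] by (meson leD)
    then show ?thesis using False ok sol unfolding minimization_answer_def by auto
  qed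
qed

lemma in_init_state:
  "i < length xs \<Longrightarrow> arr (init_state xs) ''in'' (int i) = xs ! i"
  by (simp add: init_state_def)

lemma written_offsets:
  "written_vars offsets = {''n'', ''m'', ''mm'', ''K'', ''oh'', ''ou'', ''ol'', ''ox''}"
  "written_arrs offsets = {}" "silent offsets"
  by (auto simp: offsets_def)

lemma wp_offsets:
  fixes I
  defines "n \<equiv> card (verts (net I))" and "m \<equiv> card (arcs (net I))"
  shows "wp R offsets (\<lambda>s. var s ''n'' = int n \<and> var s ''K'' = 3 * int m \<and>
    arc_inputs (int m) (\<lambda>a. int (tail (net I) (nat a))) (\<lambda>a. int (head (net I) (nat a)))
      (\<lambda>a. int (capacity I (nat a))) (\<lambda>a. int (scenario I (nat a))) (\<lambda>a. x_nom I (nat a)) s)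
    (init_state (encode_instance I))"
proof -
  let ?s = "init_state (encode_instance I)"
  note nth = encode_instance_nth[where I = I, folded n_def m_def]
  have input: "arr ?s ''in'' b = encode_instance I ! j" if "b = int j" "j < 2 + 8 * m + n" for b j
    using that in_init_state[of j "encode_instance I"] nth(1) by simp
  have 0: "arr ?s ''in'' 0 = int n" "arr ?s ''in'' 1 = int m"
    using input[of 0 0] input[of 1 1] nth(2,3) by simp_all
  have arcs: "arr ?s ''in'' (a + 2) = int (tail (net I) (nat a))"
    "arr ?s ''in'' (a + (int m + 2)) = int (head (net I) (nat a))"
    "arr ?s ''in'' (a + (2 * int m + 2)) = int (capacity I (nat a))"
    "arr ?s ''in'' (a + (6 * int m + (int n + 2))) = int (scenario I (nat a))"
    "arr ?s ''in'' (a + (7 * int m + (int n + 2))) = x_nom I (nat a)" if "0 \<le> a" "a < int m" for a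
  proof -
    define i where "i = nat a"
    have i: "a = int i" "i < m" "nat a = i" using that by (simp_all add: i_def nat_less_iff)
    show "arr ?s ''in'' (a + 2) = int (tail (net I) (nat a))"
      unfolding i(3) nth(4)[OF i(2), symmetric] by (rule input) (use i in auto)
    show "arr ?s ''in'' (a + (int m + 2)) = int (head (net I) (nat a))"
      unfolding i(3) nth(5)[OF i(2), symmetric] by (rule input) (use i in auto)
    show "arr ?s ''in'' (a + (2 * int m + 2)) = int (capacity I (nat a))"
      unfolding i(3) nth(6)[OF i(2), symmetric] by (rule input) (use i in auto)
    show "arr ?s ''in'' (a + (6 * int m + (int n + 2))) = int (scenario I (nat a))"
      unfolding i(3) nth(7)[OF i(2), symmetric] by (rule input) (use i in auto)
    show "arr ?s ''in'' (a + (7 * int m + (int n + 2))) = x_nom I (nat a)"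
      unfolding i(3) nth(8)[OF i(2), symmetric] by (rule input) (use i in auto)
  qed
  have sums: "int m + int m + 2 = 2 * int m + 2"
    "int m + int m + int m + (int m + int m + int m) + (int n + 2) = 6 * int m + int n + 2"
    "6 * int m + int n + 2 + int m = 7 * int m + int n + 2" by simp_all
  show ?thesis
    unfolding offsets_def
    by ((rule wp_Seq | rule wp_Assign, simp only: 0 sums aval.simps state.simps fun_upd_def list.inject char.inject
      simp_thms if_True if_False)+) (simp add: arc_inputs_def arcs 0)
qed

theorem corollary3p1:
  shows "poly_time_minimization MCF_reactive_instances encode_instance
    scenario_flows (\<lambda>I x. d_val (net I) x (x_nom I)) encode_flow"
  unfolding poly_time_minimization_def
proof (rule poly_time_computableI[where c = mcf_program and r = "[:1, 4:]"])
  show "mul_free mcf_program" by (rule mul_free_mcf_program)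
next
  fix I assume I: "I \<in> MCF_reactive_instances"
  define n where "n = card (verts (net I))"
  define m where "m = card (arcs (net I))"
  let ?xs = "encode_instance I"
  let ?s = "init_state ?xs" and ?B = "input_size ?xs" and ?R = "poly [:1, 4:] (input_size ?xs)"
  let ?t = "\<lambda>a. int (tail (net I) (nat a))" and ?h = "\<lambda>a. int (head (net I) (nat a))"
    and ?u = "\<lambda>a. int (capacity I (nat a))" and ?l = "\<lambda>a. int (scenario I (nat a))"
    and ?x = "\<lambda>a. x_nom I (nat a)"
  have len: "2 + 8 * m + n \<le> ?B"
    using length_le_input_size[of ?xs] encode_instance_nth(1)[of I] by (simp add: n_def m_def)
  \<comment> \<open>The loop bound must cover the \<open>3 * m\<close> arcs of the network,
    \<open>n + 1\<close> for the search measure, and \<open>3 * m + ?B\<close> for the scaling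
    levels. All of these are linear in the input size, which is at least
    \<open>2 + 8 * m + n\<close>.\<close>
  then have R: "int m \<le> int ?R" "3 * int m \<le> int ?R" "int n < int ?R" "3 * m + ?B < ?R"
    by simp_all
  have arcs: "arcs (net I) = {..<m}" and verts: "verts (net I) = {..<n}" and "fin_digraph (net I)"
    and nom: "x_nom I \<in> feasible_flows (net I) (arc_demand I) (capacity I) (node_demand I)"
    using I unfolding MCF_reactive_instances_def m_def n_def by blast+
  then have wf: "wf_digraph (net I)" by (simp add: fin_digraph_def)
  interpret correction "int m" ?t ?h ?u ?l ?x .
  show "wp ?R mcf_program (\<lambda>s. minimization_answer scenario_flows (\<lambda>I x. d_val (net I) x (x_nom I))
      encode_flow I (out_tape s)) ?s" (is "wp _ _ ?Q _")
    unfolding mcf_program_def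
  proof (rule wp_Seq[OF wp_conseq[OF wp_offsets]], fold n_def m_def)
    fix s1 assume f1: "frame offsets ?s s1" and "var s1 ''n'' = int n \<and> var s1 ''K'' = 3 * int m \<and>
      arc_inputs (int m) ?t ?h ?u ?l ?x s1"
    then have s1: "var s1 ''n'' = int n" "var s1 ''K'' = 3 * int m" "arc_inputs (int m) ?t ?h ?u ?l ?x s1"
      by auto
    have i1: "var s1 ''S'' = 0" "arr s1 = arr ?s" "out_tape s1 = []"
      using frame_var[OF f1, of "''S''"] frame_out[OF f1] frame_arr[OF f1]
      by (simp_all add: written_offsets ext) (simp_all add: init_state_def)
    have bits: "\<bar>arr s1 a i\<bar> < 2 ^ ?B" for a i
      using bits_bound_init[of ?xs] unfolding i1 bits_bound_def by blast
    have bounds: "0 \<le> ?x a \<and> ?x a < 2 ^ ?B \<and> 0 \<le> ?l a \<and> ?l a < 2 ^ ?B \<and> 0 \<le> ?u a \<and> ?u a < 2 ^ ?B"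
      if a: "0 \<le> a" "a < int m" for a
    proof -
      have "nat a \<in> arcs (net I)" using a by (auto simp: arcs nat_less_iff)
      then have "int (arc_demand I (nat a)) \<le> ?x a" using nom unfolding feasible_flows_def by blast
      then have "0 \<le> ?x a" by linarith
      moreover have "arr s1 ''in'' (a + var s1 ''ou'') = ?u a" "arr s1 ''in'' (a + var s1 ''ol'') = ?l a"
        "arr s1 ''in'' (a + var s1 ''ox'') = ?x a"
        using s1(3) a by (auto simp: arc_inputs_def)
      then have "\<bar>?u a\<bar> < 2 ^ ?B" "\<bar>?l a\<bar> < 2 ^ ?B" "\<bar>?x a\<bar> < 2 ^ ?B" using bits[of "''in''"] by metis+
      ultimately show ?thesis by auto
    qed
    show "wp ?R (build;; scaling;; answer) ?Q s1"
    proof (rule wp_Seq[OF wp_conseq[OF wp_build[OF s1(3) _ R(1) i1(1)]]])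
      fix s2 assume f2: "frame build s1 s2" and b: "blocks (arr s2 ''T'') (arr s2 ''H'') (arr s2 ''W'') (arr s2 ''C'') \<and>
        var s2 ''S'' = total_cap (int m)"
      let ?T = "arr s2 ''T''" and ?H = "arr s2 ''H''" and ?W = "arr s2 ''W''" and ?C = "arr s2 ''C''"
      have net: "correction_network (int m) ?t ?h ?u ?l ?x (int n) ?T ?H ?W ?C"
      proof
        fix b assume "0 \<le> b" "b < 3 * int m"
        then obtain a where a: "0 \<le> a" "a < int m" "b = a \<or> b = a + int m \<or> b = a + 2 * int m"
          by (rule less_three_blocks)
        then have "nat a \<in> arcs (net I)" by (auto simp: arcs nat_less_iff)
        then have "tail (net I) (nat a) \<in> verts (net I)" "head (net I) (nat a) \<in> verts (net I)"
          using wf_digraph.head_in_verts[OF wf] wf_digraph.tail_in_verts[OF wf] by blast+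
        then have "tail (net I) (nat a) < n" "head (net I) (nat a) < n" unfolding verts by auto
        then show "0 \<le> ?T b \<and> ?T b < int n" "0 \<le> ?H b \<and> ?H b < int n"
          using a b unfolding blocks_def blocks_except_cost_def by auto
      qed (use b in auto)
      interpret correction_network "int m" ?t ?h ?u ?l ?x "int n" ?T ?H ?W ?C by (rule net)
      have s2: "var s2 ''n'' = int n" "var s2 ''K'' = 3 * int m" "out_tape s2 = []"
        "arr s2 ''pi'' = (\<lambda>_. 0)" "arr s2 ''cap'' = (\<lambda>_. 0)" "arr s2 ''f'' = (\<lambda>_. 0)"
        using frame_var[OF f2, of "''n''"] frame_var[OF f2, of "''K''"] frame_out[OF f2]
          frame_arr[OF f2, of "''pi''"] frame_arr[OF f2, of "''cap''"] frame_arr[OF f2, of "''f''"] s1(1,2) i1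
        by (simp_all add: written_build) (simp_all add: init_state_def)
      have i2: "arc_inputs (int m) ?t ?h ?u ?l ?x s2"
        using s1(3) f2 by (rule arc_inputs_frame) (auto simp: written_build)
      have ns: "network_state s2" using s2 by (simp add: network_state_def)
      have S_eq: "var s2 ''S'' = total_cap (int m)" using b by blast
      have C: "0 \<le> ?C c \<and> ?C c \<le> var s2 ''S''" if "0 \<le> c" "c < 3 * int m" for c
      proof -
        obtain a where a: "0 \<le> a" "a < int m" "c = a \<or> c = a + int m \<or> c = a + 2 * int m"
          using \<open>0 \<le> c\<close> \<open>c < 3 * int m\<close> by (rule less_three_blocks)
        have "?C c \<in> {cap0 a, cap1 a, cap2 a}"
          using a(3) block_values(10-12)[OF a(1,2)] by auto
        then show ?thesis
          using total_cap_bound(3)[OF _ order_refl bounds a(1,2)] S_eq by auto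
      qed
      have S: "0 \<le> var s2 ''S''" "var s2 ''S'' < 2 ^ (3 * m + ?B)"
        using total_cap_bound(1,2)[OF _ order_refl bounds] by (simp_all add: S_eq)
      show "wp ?R (scaling;; answer) ?Q s2"
      proof (rule wp_Seq[OF wp_conseq[OF wp_scaling[OF ns R(2,3,4) s2(4-6) S C]]])
        fix s3 assume f3: "frame scaling s2 s3" and "(\<exists>p. kilter p ?C (arr s3 ''f'')) \<and>
          (\<forall>z. excess (arr s3 ''f'') z = 0)"
        then obtain p where k: "kilter p ?C (arr s3 ''f'')" and ex: "\<And>v. excess (arr s3 ''f'') v = 0"
          by blast
        have i3: "arc_inputs (int m) ?t ?h ?u ?l ?x s3"
          using i2 f3 by (rule arc_inputs_frame) auto
        have o3: "out_tape s3 = []" using f3 s2(3) by (simp add: frame_def)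
        show "wp ?R answer ?Q s3"
          by (rule wp_conseq[OF wp_answer[OF i3 _ R(1) o3]])
            (use minimization_answer_corrected[OF I, folded m_def, OF net k ex] in simp_all)
      qed
    qed simp
  qed
qed

end
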